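(* Let $n\ge 1$, $d\ge 1$ and let $k$ be an integer with $1\le k\le d/2-1$. The $k$-th order Milnor algebra $M^k(f)$ of a generic homogeneous polynomial $f\in R_d$, where $R=\mathbb{C}[x_0,\dots,x_n]$, determines the hypersurface $V(f)\subset\mathbb{P}^n$ up to projective equivalence. That is, there is a nonempty Zariski open subset $U\subset R_d$ such that for all $f,g\in U$, if $M^k(f)$ and $M^k(g)$ are isomorphic as graded $\mathbb{C}$-algebras, then $V(f)$ and $V(g)$ are projectively equivalent.
   Context: $R_d$ is the space of homogeneous polynomials of degree $d$ in $R$. $J^k(f)\subset R$ is the homogeneous ideal generated by all the $k$-th order partial derivatives of $f$, and $M^k(f)=R/J^k(f)$ is the $k$-th order Milnor algebra. Two hypersurfaces $V(f),V(g)\subset\mathbb{P}^n$ with $f,g\in R_d$ are projectively equivalent if $f$ and $g$ belong to the same orbit of $GL_{n+1}(\mathbb{C})$ acting on $R_d$ by linear substitution of variables. *)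

theory Defs
  imports
    "HOL-Analysis.Analysis"
    "HOL-Library.Poly_Mapping"
    "HOL-Algebra.Algebraic_Closure_Type"
begin

text \<open>
  Complex polynomials in the variables \<open>x\<^sub>v\<close> (\<open>v :: 'v\<close>): finitely supported maps from exponent
  vectors to coefficients, with the convolution product of \<open>HOL-Library.Poly_Mapping\<close>.
\<close>

type_synonym 'v cpoly = "('v \<Rightarrow>\<^sub>0 nat) \<Rightarrow>\<^sub>0 complex"

definition const :: "complex \<Rightarrow> 'v cpoly" where
  "const c = Poly_Mapping.single 0 c"

definition var :: "'v \<Rightarrow> 'v cpoly" where
  "var v = Poly_Mapping.single (Poly_Mapping.single v 1) 1"

definition homogeneous :: "nat \<Rightarrow> ('v::finite) cpoly set" where
  "homogeneous d =
     {p. \<forall>m \<in> Poly_Mapping.keys p. (\<Sum>v\<in>UNIV. Poly_Mapping.lookup m v) = d}"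

text \<open>
  The value of \<open>p\<close> after \<open>x\<^sub>v \<mapsto> a v\<close>, where the coefficients enter the target ring through \<open>h\<close>.
\<close>

definition insertion ::
    "(complex \<Rightarrow> 'r) \<Rightarrow> ('v \<Rightarrow> 'r) \<Rightarrow> 'v cpoly \<Rightarrow> 'r::comm_ring_1" where
  "insertion h a p =
     (\<Sum>m \<in> Poly_Mapping.keys p. h (Poly_Mapping.lookup p m) *
        (\<Prod>v \<in> Poly_Mapping.keys m. a v ^ Poly_Mapping.lookup m v))"

subsection \<open>Higher order Milnor algebras\<close>

definition partial :: "'v \<Rightarrow> 'v cpoly \<Rightarrow> 'v cpoly" where
  "partial v p =
     (\<Sum>m \<in> Poly_Mapping.keys p.
        Poly_Mapping.single (m - Poly_Mapping.single v 1)
          (of_nat (Poly_Mapping.lookup m v) * Poly_Mapping.lookup p m))"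

definition partials :: "nat \<Rightarrow> 'v cpoly \<Rightarrow> 'v cpoly set" where
  "partials k f = {foldr partial vs f | vs. length vs = k}"

abbreviation poly_ring :: "'v cpoly ring" where
  "poly_ring \<equiv> ring_of_type_algebra"

definition jacobian_ideal :: "nat \<Rightarrow> 'v cpoly \<Rightarrow> 'v cpoly set" where
  "jacobian_ideal k f = genideal poly_ring (partials k f)"

definition milnor_algebra :: "nat \<Rightarrow> 'v cpoly \<Rightarrow> 'v cpoly set ring" where
  "milnor_algebra k f = poly_ring Quot jacobian_ideal k f"

definition milnor_class :: "nat \<Rightarrow> 'v cpoly \<Rightarrow> 'v cpoly \<Rightarrow> 'v cpoly set" where
  "milnor_class k f p = jacobian_ideal k f +>\<^bsub>poly_ring\<^esub> p"

definition milnor_graded_piece :: "nat \<Rightarrow> ('v::finite) cpoly \<Rightarrow> nat \<Rightarrow> 'v cpoly set set" where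
  "milnor_graded_piece k f i = milnor_class k f ` homogeneous i"

text \<open>
  Scalars act on \<open>milnor_algebra k f\<close> by multiplication with the classes of constants, so a ring
  isomorphism is \<open>\<complex>\<close>-linear iff it matches these classes.
\<close>

definition milnor_isomorphic :: "nat \<Rightarrow> ('v::finite) cpoly \<Rightarrow> 'v cpoly \<Rightarrow> bool" where
  "milnor_isomorphic k f g \<longleftrightarrow>
     (\<exists>\<phi> \<in> ring_iso (milnor_algebra k f) (milnor_algebra k g).
        (\<forall>c. \<phi> (milnor_class k f (const c)) = milnor_class k g (const c)) \<and>
        (\<forall>i. \<phi> ` milnor_graded_piece k f i = milnor_graded_piece k g i))"

subsection \<open>Projective equivalence and the Zariski topology\<close>

definition linear_subst :: "complex^'v^'v \<Rightarrow> ('v::finite) cpoly \<Rightarrow> 'v cpoly" where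
  "linear_subst A f = insertion const (\<lambda>v. \<Sum>w\<in>UNIV. const (A $ v $ w) * var w) f"

definition projectively_equivalent :: "('v::finite) cpoly \<Rightarrow> 'v cpoly \<Rightarrow> bool" where
  "projectively_equivalent f g \<longleftrightarrow> (\<exists>A. invertible A \<and> g = linear_subst A f)"

text \<open>
  \<open>homogeneous d\<close> is an affine space whose coordinates are the coefficients of the forms, so
  polynomial functions on it are polynomials in variables indexed by exponent vectors. A Zariski
  open set is the complement of the common zero locus of a set of them. (Coordinates of exponent
  vectors of another degree vanish on \<open>homogeneous d\<close>.)
\<close>

definition zariski_open :: "nat \<Rightarrow> ('v::finite) cpoly set \<Rightarrow> bool" where
  "zariski_open d U \<longleftrightarrow>
     (\<exists>S :: ('v \<Rightarrow>\<^sub>0 nat) cpoly set.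
        U = homogeneous d - {f. \<forall>F\<in>S. insertion id (Poly_Mapping.lookup f) F = 0})"

end

theory Submission
  imports Defs "Jordan_Normal_Form.Determinant"
begin

text \<open>
  The proof recovers a generic form, up to a scalar, from the span of its partial derivatives of
  order \<open>k\<close>, and sees this span in the ideal that defines the Milnor algebra.

  The ideal \<open>J\<^sup>k(f)\<close> is generated in degree \<open>d - k \<ge> 2\<close>, so linear forms have independent classes in \<open>M\<^sup>k(f)\<close>. A graded isomorphism \<open>M\<^sup>k(f) \<rightarrow> M\<^sup>k(g)\<close> sends the class of
  each variable to the class of a linear form; these linear forms are the rows of an invertible
  matrix \<open>A\<close>, the isomorphism is induced by the substitution \<open>A\<close>, and the substitution carries
  \<open>J\<^sup>k(f)\<close> into \<open>J\<^sup>k(g)\<close> (lemma \<open>milnor_isomorphic_imp_linear_subst\<close>). In degree \<open>d - k\<close> the ideal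
  \<open>J\<^sup>k(g)\<close> is just the span of the \<open>k\<close>-th partials of \<open>g\<close>. By the chain rule, all \<open>k\<close>-th partials of
  \<open>h = f \<circ> A\<close> therefore lie in the span of the \<open>k\<close>-th partials of \<open>g\<close>.

  To get from spans to forms, write \<open>\<partial>\<^sup>a h = (\<Sum>b. T a b \<partial>\<^sup>b g)\<close> for \<open>|a| = k\<close>. Since
  \<open>\<partial>\<^sub>j (\<partial>\<^sub>i \<partial>\<^sup>c h) = \<partial>\<^sub>i (\<partial>\<^sub>j \<partial>\<^sup>c h)\<close>, there are two expressions of each partial of order \<open>k + 1\<close> of \<open>h\<close>
  through those of \<open>g\<close>. If the partials of order \<open>k + 1\<close> of \<open>g\<close> are linearly independent, then
  comparing coefficients forces \<open>T\<close> to be a scalar matrix (lemma \<open>shift_span_scalar\<close>). Hence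
  \<open>h\<close> is a multiple of \<open>g\<close>, the factor is nonzero because \<open>f\<close> is, and its \<open>d\<close>-th root can be absorbed
  into \<open>A\<close>.

  The independence of the partials of order \<open>a = k + 1\<close> of \<open>g\<close> follows when a certain square matrix of rescaled coefficients of \<open>g\<close> (a block of the catalecticant matrix, which
  exists because \<open>2 a \<le> d\<close>) has nonzero determinant. This is an open condition. It is not empty:
  if the rescaled coefficients are the moments of a finite set of points with positive coordinates,
  the matrix is positive definite as soon as no nonzero form of degree \<open>a\<close> vanishes at all the
  points, and enough points on a suitable monomial curve achieve this (lemmas \<open>moments_independent\<close> and
  \<open>generic_shift_independent\<close>).

  Derivatives are handled through the coefficients of a polynomial with respect to the basis
  \<open>x\<^sup>m / m!\<close>, because in these coordinates \<open>\<partial>\<^sub>v\<close> is a mere shift of the index \<open>m\<close>.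
\<close>

section \<open>Evaluation and linear substitution of polynomials\<close>

lemma poly_mapping_single_induct [case_names zero single_add]:
  fixes p :: "'a \<Rightarrow>\<^sub>0 'b::comm_monoid_add"
  assumes "P 0" "\<And>m c q. P q \<Longrightarrow> P (Poly_Mapping.single m c + q)"
  shows "P p"
proof (induction p rule: Poly_Mapping.update_induct)
  case const
  show ?case by (fact assms)
next
  case (update f a b)
  have "Poly_Mapping.update a b f = Poly_Mapping.single a b + f"
    using update(1)
    by (intro poly_mapping_eqI)
      (auto simp: lookup_update lookup_add lookup_single when_def in_keys_iff)
  then show ?case using update assms by metis
qed

lemma const_add: "const (a + b) = const a + const b"
  by (simp add: const_def single_add)

lemma const_mult: "const (a * b) = const a * const b"
  by (simp add: const_def mult_single)

lemma const_1 [simp]: "const 1 = 1"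
  by (simp add: const_def)

lemma const_0 [simp]: "const 0 = 0"
  by (simp add: const_def)

lemma const_power: "const a ^ n = const (a ^ n)"
  by (induction n) (auto simp: const_mult)

text \<open>
  The ring of polynomials is generated by constants and variables. This induction principle reduces
  every identity between additive and multiplicative maps, and every ideal membership, to these two
  kinds of generators.
\<close>
lemma cpoly_induct [case_names const var add mult]:
  fixes p :: "'v cpoly"
  assumes c: "\<And>c. P (const c)" and v: "\<And>v. P (var v)"
    and a: "\<And>p q. P p \<Longrightarrow> P q \<Longrightarrow> P (p + q)"
    and m: "\<And>p q. P p \<Longrightarrow> P q \<Longrightarrow> P (p * q)"
  shows "P p"
proof -
  have pw: "P (Poly_Mapping.single (Poly_Mapping.single v n) 1)" for v n
  proof (induction n)
    case 0
    show ?case using c[of 1] by (simp add: const_def)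
  next
    case (Suc n)
    have "Poly_Mapping.single (Poly_Mapping.single v (Suc n)) (1::complex)
        = var v * Poly_Mapping.single (Poly_Mapping.single v n) 1"
      by (simp add: var_def mult_single flip: single_add)
    then show ?case using m[OF v Suc, of v] by simp
  qed
  have mon: "P (Poly_Mapping.single e 1)" for e
  proof (induction e rule: poly_mapping_single_induct)
    case zero
    show ?case using c[of 1] by (simp add: const_def)
  next
    case (single_add e n q)
    then show ?case using m[OF pw[of e n] single_add] by (simp add: mult_single)
  qed
  show ?thesis
  proof (induction p rule: poly_mapping_single_induct)
    case zero
    show ?case using c[of 0] by simp
  next
    case (single_add e b q)
    have "Poly_Mapping.single e b = const b * Poly_Mapping.single e 1"
      by (simp add: const_def mult_single)
    then show ?case using a[OF m[OF c mon] single_add] by simp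
  qed
qed

definition scalar_hom :: "(complex \<Rightarrow> 'r::comm_ring_1) \<Rightarrow> bool" where
  "scalar_hom h \<longleftrightarrow> h 1 = 1 \<and> (\<forall>a b. h (a + b) = h a + h b) \<and> (\<forall>a b. h (a * b) = h a * h b)"

lemma scalar_hom_0: "scalar_hom h \<Longrightarrow> h 0 = 0"
  by (metis add_cancel_right_right scalar_hom_def add_0)

lemma scalar_hom_const [simp]: "scalar_hom const"
  by (simp add: scalar_hom_def const_add const_mult)

lemma scalar_hom_id [simp]: "scalar_hom id"
  by (simp add: scalar_hom_def)

definition monom_value :: "('v \<Rightarrow> 'r::comm_ring_1) \<Rightarrow> ('v \<Rightarrow>\<^sub>0 nat) \<Rightarrow> 'r" where
  "monom_value a m = (\<Prod>v \<in> Poly_Mapping.keys m. a v ^ Poly_Mapping.lookup m v)"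

lemma monom_value_superset:
  assumes "finite V" "Poly_Mapping.keys m \<subseteq> V"
  shows "monom_value a m = (\<Prod>v\<in>V. a v ^ Poly_Mapping.lookup m v)"
  unfolding monom_value_def using assms
  by (intro prod.mono_neutral_left) (auto simp: in_keys_iff)

lemma monom_value_add: "monom_value a (m + n) = monom_value a m * monom_value a n"
proof -
  let ?V = "Poly_Mapping.keys m \<union> Poly_Mapping.keys n"
  have "Poly_Mapping.keys (m + n) \<subseteq> ?V" by (rule keys_add)
  then show ?thesis
    by (simp add: monom_value_superset[of ?V] lookup_add power_add prod.distrib)
qed

lemma insertion_alt: "insertion h a p =
    (\<Sum>m \<in> Poly_Mapping.keys p. h (Poly_Mapping.lookup p m) * monom_value a m)"
  by (simp add: insertion_def monom_value_def)

lemma insertion_add: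
  assumes "scalar_hom h"
  shows "insertion h a (p + q) = insertion h a p + insertion h a q"
  unfolding insertion_alt using assms scalar_hom_0[OF assms]
  by (intro setsum_keys_plus_distrib) (auto simp: scalar_hom_def algebra_simps)

lemma insertion_single:
  assumes "scalar_hom h"
  shows "insertion h a (Poly_Mapping.single m c) = h c * monom_value a m"
  using scalar_hom_0[OF assms] by (simp add: insertion_alt)

lemma insertion_0 [simp]: "insertion h a 0 = 0"
  by (simp add: insertion_def)

lemma insertion_mult:
  assumes h: "scalar_hom h"
  shows "insertion h a (p * q) = insertion h a p * insertion h a q"
proof (induction p rule: poly_mapping_single_induct)
  case (single_add m c p)
  have "insertion h a (Poly_Mapping.single m c * q)
      = insertion h a (Poly_Mapping.single m c) * insertion h a q"
  proof (induction q rule: poly_mapping_single_induct)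
    case (single_add n b q)
    then show ?case using h
      by (simp add: distrib_left insertion_add[OF h] mult_single insertion_single[OF h]
          monom_value_add scalar_hom_def mult_ac)
  qed simp
  with single_add show ?case by (simp add: distrib_right insertion_add[OF h])
qed simp

lemma insertion_const [simp]: "scalar_hom h \<Longrightarrow> insertion h a (const c) = h c"
  by (simp add: const_def insertion_single monom_value_def)

lemma insertion_var [simp]: "scalar_hom h \<Longrightarrow> insertion h a (var v) = a v"
  by (simp add: var_def insertion_single monom_value_def) (simp add: scalar_hom_def)

lemma insertion_1 [simp]: "scalar_hom h \<Longrightarrow> insertion h a 1 = 1"
  using insertion_const[of h a 1] by (simp add: scalar_hom_def)

definition linear_form :: "complex^'v^'v \<Rightarrow> 'v::finite \<Rightarrow> 'v cpoly" where
  "linear_form A v = (\<Sum>w\<in>UNIV. const (vec_nth (vec_nth A v) w) * var w)"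

lemma linear_subst_alt: "linear_subst A = insertion const (linear_form A)"
  by (simp add: fun_eq_iff linear_subst_def linear_form_def[abs_def])

lemma linear_subst_add: "linear_subst A (p + q) = linear_subst A p + linear_subst A q"
  and linear_subst_mult: "linear_subst A (p * q) = linear_subst A p * linear_subst A q"
  and linear_subst_const [simp]: "linear_subst A (const c) = const c"
  and linear_subst_var [simp]: "linear_subst A (var v) = linear_form A v"
  and linear_subst_0 [simp]: "linear_subst A 0 = 0"
  by (simp_all add: linear_subst_alt insertion_add insertion_mult)

lemma linear_subst_sum: "linear_subst A (sum f I) = (\<Sum>i\<in>I. linear_subst A (f i))"
  by (induction I rule: infinite_finite_induct) (auto simp: linear_subst_add)

lemma const_sum: "const (sum f I) = (\<Sum>i\<in>I. const (f i))"
  by (induction I rule: infinite_finite_induct) (auto simp: const_add)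

text \<open>A substitution acts on the variables, so the matrix of the one performed first stands on the left.\<close>
lemma linear_subst_compose:
  "linear_subst B (linear_subst A p) = linear_subst (A ** B) p"
proof (induction p rule: cpoly_induct)
  case (var v)
  have "linear_subst B (linear_form A v) =
      (\<Sum>w\<in>UNIV. \<Sum>u\<in>UNIV. const (vec_nth (vec_nth A v) w * vec_nth (vec_nth B w) u) * var u)"
    by (simp add: linear_form_def linear_subst_sum linear_subst_mult sum_distrib_left const_mult
        mult.assoc)
  also have "\<dots> = linear_form (A ** B) v"
    by (subst sum.swap)
      (simp add: linear_form_def matrix_matrix_mult_def const_sum sum_distrib_right)
  finally show ?case by simp
qed (auto simp: linear_subst_add linear_subst_mult)

lemma linear_subst_mat_1: "linear_subst (Finite_Cartesian_Product.mat 1) p = p"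
proof (induction p rule: cpoly_induct)
  case (var v)
  have "linear_form (Finite_Cartesian_Product.mat 1) v = (\<Sum>w\<in>UNIV. if v = w then var w else 0)"
    unfolding linear_form_def by (intro sum.cong) (auto simp: Finite_Cartesian_Product.mat_def)
  then show ?case by simp
qed (auto simp: linear_subst_add linear_subst_mult)

lemma linear_subst_eq_0:
  assumes "invertible A" "linear_subst A p = 0"
  shows "p = 0"
proof -
  obtain B where "A ** B = Finite_Cartesian_Product.mat 1" using assms(1) unfolding invertible_def by blast
  then have "p = linear_subst B (linear_subst A p)"
    by (simp add: linear_subst_compose linear_subst_mat_1)
  then show ?thesis using assms(2) by simp
qed

definition total_degree :: "('v::finite \<Rightarrow>\<^sub>0 nat) \<Rightarrow> nat" where
  "total_degree m = (\<Sum>v\<in>UNIV. Poly_Mapping.lookup m v)"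

lemma total_degree_add [simp]: "total_degree (m + n) = total_degree m + total_degree n"
  by (simp add: total_degree_def lookup_add sum.distrib)

lemma total_degree_single [simp]: "total_degree (Poly_Mapping.single v n) = n"
  by (simp add: total_degree_def lookup_single when_def)

lemma total_degree_0 [simp]: "total_degree 0 = 0"
  by (simp add: total_degree_def)

abbreviation unit_exp :: "'v \<Rightarrow> ('v \<Rightarrow>\<^sub>0 nat)" where
  "unit_exp v \<equiv> Poly_Mapping.single v 1"

lemma total_degree_eq_0: "total_degree m = 0 \<longleftrightarrow> m = 0"
  by (auto simp: total_degree_def poly_mapping_eq_iff fun_eq_iff)

lemma homogeneous_iff:
  "p \<in> homogeneous d \<longleftrightarrow> (\<forall>m. total_degree m \<noteq> d \<longrightarrow> Poly_Mapping.lookup p m = 0)"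
  unfolding homogeneous_def total_degree_def by (auto simp: in_keys_iff)

lemma homogeneous_sum: "(\<And>i. i \<in> I \<Longrightarrow> f i \<in> homogeneous d) \<Longrightarrow> sum f I \<in> homogeneous d"
  by (auto simp: homogeneous_iff lookup_sum)

lemma homogeneous_mult:
  assumes "p \<in> homogeneous a" "q \<in> homogeneous b"
  shows "p * q \<in> homogeneous (a + b)"
  using assms keys_mult[of p q] unfolding homogeneous_def total_degree_def[symmetric] by fastforce

lemma homogeneous_const [simp]: "const c \<in> homogeneous 0"
  by (auto simp: homogeneous_iff const_def lookup_single when_def)

lemma homogeneous_var [simp]: "var v \<in> homogeneous 1"
  by (auto simp: homogeneous_iff var_def lookup_single when_def)

lemma homogeneous_power: "p \<in> homogeneous a \<Longrightarrow> p ^ n \<in> homogeneous (n * a)"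
  by (induction n) (use homogeneous_const[of 1] in \<open>auto intro: homogeneous_mult\<close>)

lemma homogeneous_prod:
  "(\<And>i. i \<in> I \<Longrightarrow> f i \<in> homogeneous (e i)) \<Longrightarrow> prod f I \<in> homogeneous (sum e I)"
  by (induction I rule: infinite_finite_induct)
    (use homogeneous_const[of 1] in \<open>auto intro: homogeneous_mult\<close>)

lemma homogeneous_linear_form: "linear_form A v \<in> homogeneous 1"
  unfolding linear_form_def
  by (intro homogeneous_sum) (use homogeneous_mult[OF homogeneous_const homogeneous_var] in auto)

lemma homogeneous_const_mult: "p \<in> homogeneous d \<Longrightarrow> const c * p \<in> homogeneous d"
  using homogeneous_mult[OF homogeneous_const] by fastforce

lemma homogeneous_linear_subst:
  assumes "p \<in> homogeneous d"
  shows "linear_subst A p \<in> homogeneous d"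
  unfolding linear_subst_alt insertion_alt
proof (intro homogeneous_sum homogeneous_const_mult)
  fix m assume m: "m \<in> Poly_Mapping.keys p"
  have "(\<Prod>v\<in>UNIV. linear_form A v ^ Poly_Mapping.lookup m v)
      \<in> homogeneous (\<Sum>v\<in>UNIV. Poly_Mapping.lookup m v * 1)"
    by (intro homogeneous_prod homogeneous_power homogeneous_linear_form)
  then show "monom_value (linear_form A) m \<in> homogeneous d"
    using assms m by (simp add: monom_value_superset[of UNIV] homogeneous_def)
qed

lemma lookup_const_mult: "Poly_Mapping.lookup (const c * p) m = c * Poly_Mapping.lookup p m"
proof (induction p rule: poly_mapping_single_induct)
  case (single_add n b q)
  then show ?case
    by (simp add: distrib_left lookup_add const_def mult_single lookup_single when_def)
qed simp

text \<open>
  Scaling the matrix of a substitution by \<open>s\<close> scales a form of degree \<open>d\<close> by \<open>s\<^sup>d\<close>. Scalar factors of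
  forms are therefore harmless for projective equivalence over \<open>\<complex>\<close>.
\<close>
lemma linear_subst_scale:
  assumes "p \<in> homogeneous d"
  shows "linear_subst (\<chi> i j. s * vec_nth (vec_nth A i) j) p = const (s ^ d) * linear_subst A p"
proof -
  have lf: "linear_form (\<chi> i j. s * vec_nth (vec_nth A i) j) v = const s * linear_form A v" for v
    by (simp add: linear_form_def sum_distrib_left const_mult mult.assoc)
  have "monom_value (linear_form (\<chi> i j. s * vec_nth (vec_nth A i) j)) m
      = const (s ^ d) * monom_value (linear_form A) m" if "m \<in> Poly_Mapping.keys p" for m
  proof -
    have "monom_value (linear_form (\<chi> i j. s * vec_nth (vec_nth A i) j)) m =
        (\<Prod>v\<in>UNIV. const s ^ Poly_Mapping.lookup m v) * monom_value (linear_form A) m"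
      by (simp add: monom_value_superset[of UNIV] lf power_mult_distrib prod.distrib)
    also have "(\<Prod>v\<in>UNIV. const s ^ Poly_Mapping.lookup m v) = const s ^ d"
      using assms that by (simp add: homogeneous_def flip: power_sum)
    finally show ?thesis by (simp add: const_power)
  qed
  then show ?thesis
    by (simp add: linear_subst_alt insertion_alt sum_distrib_left mult_ac)
qed

section \<open>Derivatives as shifts of coefficients\<close>

lemma total_degree_cases_unit:
  assumes "total_degree m = Suc k"
  obtains v n where "m = n + unit_exp v" "total_degree n = k"
proof -
  have "m \<noteq> 0" using assms by auto
  then obtain v where v: "Poly_Mapping.lookup m v \<noteq> 0"
    by (metis lookup_zero poly_mapping_eqI)
  have "m = (m - unit_exp v) + unit_exp v"
    using v by (intro poly_mapping_eqI) (auto simp: lookup_add lookup_minus lookup_single when_def)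
  moreover from this have "total_degree (m - unit_exp v) = k"
    using assms by (metis Suc_eq_plus1 add_right_cancel total_degree_add total_degree_single)
  ultimately show ?thesis using that by blast
qed

definition exponents :: "nat \<Rightarrow> ('v::finite \<Rightarrow>\<^sub>0 nat) set" where
  "exponents k = {m. total_degree m = k}"

lemma exponents_iff [simp]: "m \<in> exponents k \<longleftrightarrow> total_degree m = k"
  by (simp add: exponents_def)

lemma finite_exponents [simp, intro]: "finite (exponents k :: ('v::finite \<Rightarrow>\<^sub>0 nat) set)"
proof (induction k)
  case 0
  show ?case by (simp add: exponents_def total_degree_eq_0)
next
  case (Suc k)
  have "(exponents (Suc k) :: ('v \<Rightarrow>\<^sub>0 nat) set)
      \<subseteq> (\<lambda>(n, v). n + unit_exp v) ` (exponents k \<times> UNIV)"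
  proof
    fix m :: "'v \<Rightarrow>\<^sub>0 nat" assume "m \<in> exponents (Suc k)"
    then have "total_degree m = Suc k" by simp
    from total_degree_cases_unit[OF this] obtain v n where "m = n + unit_exp v" "total_degree n = k" .
    then show "m \<in> (\<lambda>(n, v). n + unit_exp v) ` (exponents k \<times> UNIV)"
      by (intro image_eqI[of _ _ "(n, v)"]) auto
  qed
  moreover have "finite ((\<lambda>(n, v). n + unit_exp v) ` (exponents k \<times> (UNIV :: 'v set)))"
    using Suc by auto
  ultimately show ?case by (rule finite_subset)
qed

lemma partial_add: "partial v (p + q) = partial v p + partial v q"
  unfolding partial_def by (intro setsum_keys_plus_distrib) (auto simp: distrib_left single_add)

lemma partial_0 [simp]: "partial v 0 = 0"
  by (simp add: partial_def)

lemma partial_single: "partial v (Poly_Mapping.single m c) =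
   Poly_Mapping.single (m - unit_exp v) (of_nat (Poly_Mapping.lookup m v) * c)"
  by (simp add: partial_def)

lemma exponent_diff_unit:
  assumes "Poly_Mapping.lookup m v \<noteq> (0::nat)"
  shows "m - unit_exp v + unit_exp v = m"
  using assms by (intro poly_mapping_eqI) (auto simp: lookup_add lookup_minus lookup_single when_def)

lemma lookup_partial:
  "Poly_Mapping.lookup (partial v p) m =
     of_nat (Poly_Mapping.lookup m v + 1) * Poly_Mapping.lookup p (m + unit_exp v)"
proof (induction p rule: poly_mapping_single_induct)
  case (single_add n c q)
  have "Poly_Mapping.lookup (partial v (Poly_Mapping.single n c)) m =
     of_nat (Poly_Mapping.lookup m v + 1) *
       Poly_Mapping.lookup (Poly_Mapping.single n c) (m + unit_exp v)"
  proof (cases "n = m + unit_exp v")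
    case True
    then show ?thesis by (simp add: partial_single lookup_add)
  next
    case False
    then have "Poly_Mapping.lookup n v = 0 \<or> n - unit_exp v \<noteq> m"
      using exponent_diff_unit[of n v] by auto
    with False show ?thesis by (auto simp: partial_single lookup_single when_def)
  qed
  with single_add show ?case by (simp add: partial_add lookup_add distrib_left)
qed simp

lemma partial_const [simp]: "partial v (const c) = 0"
  by (simp add: const_def partial_single)

lemma partial_var: "partial v (var w) = (if v = w then 1 else 0)"
  by (auto simp: var_def partial_single lookup_single when_def)

lemma partial_mult_single_single:
  "partial v (Poly_Mapping.single m a * Poly_Mapping.single n b) =
    partial v (Poly_Mapping.single m a) * Poly_Mapping.single n b
    + Poly_Mapping.single m a * partial v (Poly_Mapping.single n b)"
proof -
  have *: "Poly_Mapping.single (m - unit_exp v + n) (of_nat (Poly_Mapping.lookup m v) * c)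
    = Poly_Mapping.single (m + n - unit_exp v) (of_nat (Poly_Mapping.lookup m v) * c)"
    for m n and c :: complex
  proof (cases "Poly_Mapping.lookup m v = 0")
    case False
    then have "m - unit_exp v + n = m + n - unit_exp v"
      by (intro poly_mapping_eqI) (auto simp: lookup_add lookup_minus lookup_single when_def)
    then show ?thesis by simp
  qed simp
  show ?thesis
    using *[of m n "a * b"] *[of n m "a * b"]
    by (simp add: mult_single partial_single lookup_add distrib_left distrib_right single_add
        add.commute mult_ac)
qed

lemma partial_mult: "partial v (p * q) = partial v p * q + p * partial v q"
proof (induction p rule: poly_mapping_single_induct)
  case (single_add m a p)
  have "partial v (Poly_Mapping.single m a * q)
      = partial v (Poly_Mapping.single m a) * q + Poly_Mapping.single m a * partial v q"
    by (induction q rule: poly_mapping_single_induct)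
      (simp_all add: distrib_left partial_add partial_mult_single_single)
  with single_add show ?case by (simp add: distrib_right partial_add)
qed simp

lemma partial_sum: "partial v (sum f I) = (\<Sum>i\<in>I. partial v (f i))"
  by (induction I rule: infinite_finite_induct) (auto simp: partial_add)

lemma partial_const_mult: "partial v (const c * p) = const c * partial v p"
  by (simp add: partial_mult)

lemma partial_linear_form: "partial w (linear_form A v) = const (vec_nth (vec_nth A v) w)"
proof -
  have "partial w (linear_form A v)
      = (\<Sum>u\<in>UNIV. if w = u then const (vec_nth (vec_nth A v) u) else 0)"
    unfolding linear_form_def partial_sum
    by (intro sum.cong) (auto simp: partial_const_mult partial_var)
  then show ?thesis by simp
qed

text \<open>
  The chain rule for linear substitutions. Both sides satisfy the same product rule, so it is
  enough to compare them on constants and variables.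
\<close>
lemma partial_linear_subst:
  "partial w (linear_subst A p) =
     (\<Sum>v\<in>UNIV. const (vec_nth (vec_nth A v) w) * linear_subst A (partial v p))"
proof (induction p rule: cpoly_induct)
  case (var u)
  have "(\<Sum>v\<in>UNIV. const (vec_nth (vec_nth A v) w) * linear_subst A (partial v (var u)))
      = (\<Sum>v\<in>UNIV. if u = v then const (vec_nth (vec_nth A v) w) else 0)"
    using linear_subst_const[of A 1]
    by (intro sum.cong) (auto simp: partial_var simp del: linear_subst_const)
  then show ?case by (simp add: partial_linear_form)
next
  case (add p q)
  then show ?case by (simp add: linear_subst_add partial_add distrib_left sum.distrib)
next
  case (mult p q)
  then show ?case
    by (simp add: linear_subst_mult linear_subst_add partial_mult distrib_left sum.distrib
        sum_distrib_left sum_distrib_right mult_ac)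
qed simp

text \<open>
  The coefficient of \<open>p\<close> with respect to the divided power basis \<open>x\<^sup>m / m!\<close>. In this basis \<open>\<partial>\<^sub>v\<close> maps
  the basis vector of index \<open>m + e\<^sub>v\<close> to that of index \<open>m\<close>, so it shifts coefficients without
  introducing numerical factors.
\<close>
definition divided_coeff :: "('v::finite) cpoly \<Rightarrow> ('v \<Rightarrow>\<^sub>0 nat) \<Rightarrow> complex" where
  "divided_coeff p m = (\<Prod>v\<in>UNIV. fact (Poly_Mapping.lookup m v)) * Poly_Mapping.lookup p m"

lemma divided_coeff_eq_0_iff: "divided_coeff p m = 0 \<longleftrightarrow> Poly_Mapping.lookup p m = 0"
  by (simp add: divided_coeff_def)

lemma divided_coeff_add: "divided_coeff (p + q) m = divided_coeff p m + divided_coeff q m"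
  by (simp add: divided_coeff_def lookup_add distrib_left)

lemma divided_coeff_const_mult: "divided_coeff (const c * p) m = c * divided_coeff p m"
  by (simp add: divided_coeff_def lookup_const_mult)

lemma divided_coeff_0 [simp]: "divided_coeff 0 m = 0"
  by (simp add: divided_coeff_def)

lemma divided_coeff_sum: "divided_coeff (sum f I) m = (\<Sum>i\<in>I. divided_coeff (f i) m)"
  by (induction I rule: infinite_finite_induct) (auto simp: divided_coeff_add)

lemma divided_coeff_eqI: "(\<And>m. divided_coeff p m = divided_coeff q m) \<Longrightarrow> p = q"
  by (intro poly_mapping_eqI) (simp add: divided_coeff_def)

lemma divided_coeff_partial: "divided_coeff (partial v p) m = divided_coeff p (m + unit_exp v)"
proof -
  have "(\<Prod>u\<in>UNIV. fact (Poly_Mapping.lookup (m + unit_exp v) u) :: complex)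
      = (\<Prod>u\<in>UNIV. (if v = u then of_nat (Poly_Mapping.lookup m v + 1) else 1)
           * fact (Poly_Mapping.lookup m u))"
    by (intro prod.cong) (auto simp: lookup_add lookup_single when_def)
  also have "\<dots> = of_nat (Poly_Mapping.lookup m v + 1) * (\<Prod>u\<in>UNIV. fact (Poly_Mapping.lookup m u))"
    by (subst prod.distrib) simp
  finally show ?thesis by (simp add: divided_coeff_def lookup_partial)
qed

definition exponent_of :: "'v list \<Rightarrow> ('v \<Rightarrow>\<^sub>0 nat)" where
  "exponent_of vs = (\<Sum>v\<leftarrow>vs. unit_exp v)"

lemma divided_coeff_partials: "divided_coeff (foldr partial vs p) m = divided_coeff p (m + exponent_of vs)"
  by (induction vs arbitrary: m) (auto simp: exponent_of_def divided_coeff_partial add_ac)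

lemma total_degree_exponent_of: "total_degree (exponent_of vs) = length vs"
  by (induction vs) (auto simp: exponent_of_def)

lemma exponent_of_surj:
  assumes "total_degree m = k"
  obtains vs where "length vs = k" "exponent_of vs = m"
proof -
  have "\<exists>vs. length vs = k \<and> exponent_of vs = m"
    using assms
  proof (induction k arbitrary: m)
    case 0
    then show ?case by (simp add: exponent_of_def total_degree_eq_0)
  next
    case (Suc k)
    from total_degree_cases_unit[OF Suc.prems] obtain v n
      where n: "m = n + unit_exp v" "total_degree n = k" .
    with Suc.IH obtain vs where "length vs = k" "exponent_of vs = n" by blast
    with n show ?case by (intro exI[of _ "v # vs"]) (auto simp: exponent_of_def add_ac)
  qed
  then show ?thesis using that by blast
qed

lemma foldr_partial_add: "foldr partial vs (p + q) = foldr partial vs p + foldr partial vs q"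
  by (induction vs) (auto simp: partial_add)

lemma foldr_partial_sum: "foldr partial vs (sum f I) = (\<Sum>i\<in>I. foldr partial vs (f i))"
proof -
  have "foldr partial vs 0 = 0" by (induction vs) auto
  then show ?thesis
    by (induction I rule: infinite_finite_induct) (auto simp: foldr_partial_add)
qed

lemma foldr_partial_const_mult: "foldr partial vs (const c * p) = const c * foldr partial vs p"
  by (induction vs) (auto simp: partial_const_mult)

text \<open>
  The iterated chain rule without its coefficients: the partials of order \<open>k\<close> of a
  transformed polynomial are linear combinations of the transformed partials, so that they lie in
  every subspace \<open>W\<close> that contains the latter.
\<close>
lemma partials_linear_subst_mem:
  fixes p :: "('v::finite) cpoly"
  assumes sum: "\<And>f :: 'v \<Rightarrow> 'v cpoly. (\<And>v. f v \<in> W) \<Longrightarrow> (\<Sum>v\<in>UNIV. f v) \<in> W"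
    and scale: "\<And>c p. p \<in> W \<Longrightarrow> const c * p \<in> W"
    and mem: "\<And>q. q \<in> partials k p \<Longrightarrow> linear_subst A q \<in> W"
    and h: "h \<in> partials k (linear_subst A p)"
  shows "h \<in> W"
proof -
  have "foldr partial vs (linear_subst A p) \<in> W"
    if "\<And>ws. length ws = length vs \<Longrightarrow> linear_subst A (foldr partial ws p) \<in> W" for vs
    using that
  proof (induction vs arbitrary: p rule: rev_induct)
    case Nil
    then show ?case by simp
  next
    case (snoc v vs)
    have IH: "foldr partial vs (linear_subst A (partial u p)) \<in> W" for u
      using snoc.prems[of "_ @ [u]"] by (intro snoc.IH) auto
    have "(\<Sum>u\<in>UNIV. const (vec_nth (vec_nth A u) v) *
        foldr partial vs (linear_subst A (partial u p))) \<in> W"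
      by (intro sum scale IH)
    then show ?case
      by (simp add: partial_linear_subst foldr_partial_sum foldr_partial_const_mult)
  qed
  moreover obtain vs where "h = foldr partial vs (linear_subst A p)" "length vs = k"
    using h by (auto simp: partials_def)
  ultimately show ?thesis using mem by (auto simp: partials_def)
qed

lemma partial_homogeneous:
  assumes "p \<in> homogeneous d"
  shows "partial v p \<in> homogeneous (d - 1)"
  using assms unfolding homogeneous_iff lookup_partial by auto

lemma foldr_partial_homogeneous:
  assumes "p \<in> homogeneous d"
  shows "foldr partial vs p \<in> homogeneous (d - length vs)"
  using assms by (induction vs) (auto dest: partial_homogeneous)

section \<open>Functions on exponents whose shifts span the same space\<close>

text \<open>
  For \<open>G = divided_coeff g\<close> the shifts of \<open>G\<close> are the partial derivatives of \<open>g\<close>. The definition then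
  says that no nonzero differential operator with constant coefficients that is homogeneous of
  order \<open>a\<close> annihilates \<open>g\<close>.
\<close>
definition shift_independent :: "nat \<Rightarrow> (('v::finite \<Rightarrow>\<^sub>0 nat) \<Rightarrow> complex) \<Rightarrow> bool" where
  "shift_independent a G \<longleftrightarrow>
     (\<forall>c. (\<forall>m. (\<Sum>b\<in>exponents a. c b * G (m + b)) = 0) \<longrightarrow> (\<forall>b\<in>exponents a. c b = 0))"

text \<open>
  For \<open>F b = \<partial>\<^sup>b g\<close> this rewrites \<open>\<partial>\<^sub>j (\<Sum>b. T b \<partial>\<^sup>b g)\<close> as a combination of the partials of order
  \<open>k + 1\<close>, so that coefficients can be compared for different \<open>j\<close>.
\<close>
lemma sum_shift_unit:
  fixes F :: "('v::finite \<Rightarrow>\<^sub>0 nat) \<Rightarrow> complex"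
  shows "(\<Sum>b\<in>exponents k. T b * F (b + unit_exp j)) =
    (\<Sum>g\<in>exponents (Suc k). (if Poly_Mapping.lookup g j = 0 then 0 else T (g - unit_exp j)) * F g)"
proof -
  have "(\<Sum>g\<in>exponents (Suc k). (if Poly_Mapping.lookup g j = 0 then 0 else T (g - unit_exp j)) * F g)
    = (\<Sum>g\<in>{g \<in> exponents (Suc k). Poly_Mapping.lookup g j \<noteq> 0}. T (g - unit_exp j) * F g)"
    by (intro sum.mono_neutral_cong_right) auto
  also have "\<dots> = (\<Sum>b\<in>exponents k. T b * F (b + unit_exp j))"
  proof (rule sum.reindex_bij_witness[of _ "\<lambda>b. b + unit_exp j" "\<lambda>g. g - unit_exp j"])
    fix g assume g: "g \<in> {g \<in> exponents (Suc k). Poly_Mapping.lookup g j \<noteq> 0}"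
    then show *: "g - unit_exp j + unit_exp j = g" by (intro exponent_diff_unit) simp
    have "total_degree (g - unit_exp j) + 1 = total_degree g" by (metis * total_degree_add total_degree_single)
    then show "g - unit_exp j \<in> exponents k" using g by simp
    show "T (g - unit_exp j) * F (g - unit_exp j + unit_exp j) = T (g - unit_exp j) * F g"
      using * by simp
  qed (auto simp: lookup_add)
  finally show ?thesis by simp
qed

lemma unit_exp_diff_swap:
  assumes "i \<noteq> j" "Poly_Mapping.lookup m i \<noteq> 0"
  shows "Poly_Mapping.lookup (m - unit_exp i + unit_exp j) l =
    (if l = i then Poly_Mapping.lookup m i - 1 else if l = j then Poly_Mapping.lookup m j + 1
     else Poly_Mapping.lookup m l)"
  using assms by (auto simp: lookup_add lookup_minus lookup_single when_def)

lemma total_degree_swap: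
  assumes "Poly_Mapping.lookup m i \<noteq> 0"
  shows "total_degree (m - unit_exp i + unit_exp j) = total_degree m"
proof -
  have "total_degree (m - unit_exp i) + 1 = total_degree m"
    by (metis exponent_diff_unit[OF assms] total_degree_add total_degree_single)
  then show ?thesis by simp
qed

text \<open>
  This is the heart of the theorem. The hypothesis \<open>span\<close> says that the partials of order \<open>k\<close> of \<open>h\<close>
  lie in the span of those of \<open>g\<close>, say through the coefficients \<open>T a b\<close>. The symmetry of the partials
  of order \<open>k + 1\<close> of \<open>h\<close>, together with the independence of those of \<open>g\<close>, gives
  \<open>T (c + e\<^sub>i) (u - e\<^sub>j) = T (c + e\<^sub>j) (u - e\<^sub>i)\<close> for \<open>|c| = k - 1\<close> and \<open>|u| = k + 1\<close>, where a term
  whose index has a negative entry is zero. Read with \<open>u\<^sub>i = 0 < u\<^sub>j\<close> this says that \<open>T a b\<close> vanishes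
  when \<open>b\<^sub>i = 0 < a\<^sub>i\<close>; if \<open>u\<^sub>i\<close> and \<open>u\<^sub>j\<close> are positive, it says that \<open>T a b\<close> does not change when a unit is moved from \<open>i\<close> to \<open>j\<close> in both indices at once. Moving units
  reduces every off-diagonal entry to a vanishing one, and connects any two diagonal entries.
\<close>
lemma shift_span_scalar:
  fixes G H :: "('v::finite \<Rightarrow>\<^sub>0 nat) \<Rightarrow> complex"
  assumes two: "CARD('v) \<ge> 2" and k: "k \<ge> 1"
    and indep: "shift_independent (Suc k) G"
    and span: "\<And>a. total_degree a = k \<Longrightarrow> \<exists>c. \<forall>m. H (m + a) = (\<Sum>b\<in>exponents k. c b * G (m + b))"
  shows "\<exists>c. \<forall>m. total_degree m \<ge> k \<longrightarrow> H m = c * G m"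
proof -
  obtain T where T: "\<And>a m. total_degree a = k \<Longrightarrow> H (m + a) = (\<Sum>b\<in>exponents k. T a b * G (m + b))"
    using span by metis
  define T' where "T' a j g = (if Poly_Mapping.lookup g j = 0 then 0 else T a (g - unit_exp j))"
    for a g and j :: 'v
  \<comment> \<open>Both sides are the coefficient at \<open>g\<close> of \<open>\<partial>\<^sub>i \<partial>\<^sub>j \<partial>\<^sup>a h\<close>, expanded in the two possible orders.\<close>
  have sym: "T' (a + unit_exp i) j g = T' (a + unit_exp j) i g"
    if a: "Suc (total_degree a) = k" and g: "total_degree g = Suc k" for a g i j
  proof -
    have H: "H (m + (a + unit_exp i + unit_exp j))
        = (\<Sum>g\<in>exponents (Suc k). T' (a + unit_exp i) j g * G (m + g))" for m i j
    proof -
      have "H (m + (a + unit_exp i + unit_exp j)) = H ((m + unit_exp j) + (a + unit_exp i))"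
        by (simp add: add_ac)
      also have "\<dots> = (\<Sum>b\<in>exponents k. T (a + unit_exp i) b * G (m + (b + unit_exp j)))"
        using a by (subst T) (auto simp: add_ac)
      also have "\<dots> = (\<Sum>g\<in>exponents (Suc k). T' (a + unit_exp i) j g * G (m + g))"
        unfolding T'_def by (rule sum_shift_unit[where F = "\<lambda>b. G (m + b)"])
      finally show ?thesis .
    qed
    have "(\<Sum>g\<in>exponents (Suc k). (T' (a + unit_exp i) j g - T' (a + unit_exp j) i g) * G (m + g)) = 0"
      for m
      using H[of m i j] H[of m j i] by (simp add: left_diff_distrib sum_subtractf add_ac)
    then have "\<forall>g\<in>exponents (Suc k). T' (a + unit_exp i) j g - T' (a + unit_exp j) i g = 0"
      using indep[unfolded shift_independent_def, rule_format,
          of "\<lambda>g. T' (a + unit_exp i) j g - T' (a + unit_exp j) i g"] by blast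
    then show ?thesis using g by auto
  qed
  have other: "\<exists>j. j \<noteq> i" for i :: 'v
  proof (rule ccontr)
    assume "\<not> ?thesis"
    then have "(UNIV :: 'v set) = {i}" by auto
    then have "CARD('v) = 1" by (metis card.empty card.insert empty_iff finite.emptyI One_nat_def)
    then show False using two by simp
  qed
  have vanish: "T a b = 0"
    if "total_degree a = k" "total_degree b = k" "Poly_Mapping.lookup a i \<noteq> 0" "Poly_Mapping.lookup b i = 0" for a b i
  proof -
    obtain j where j: "j \<noteq> i" using other by blast
    have a: "a - unit_exp i + unit_exp i = a" using that by (intro exponent_diff_unit) simp
    then have "Suc (total_degree (a - unit_exp i)) = k"
      using that by (metis Suc_eq_plus1 total_degree_add total_degree_single)
    from sym[OF this, of "b + unit_exp j" i j] show ?thesis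
      using a that j by (auto simp: T'_def lookup_add lookup_single when_def)
  qed
  have move: "T a b = T (a - unit_exp i + unit_exp j) (b - unit_exp i + unit_exp j)"
    if "total_degree a = k" "total_degree b = k" "Poly_Mapping.lookup a i \<noteq> 0" "Poly_Mapping.lookup b i \<noteq> 0" for a b i j
  proof -
    have a: "a - unit_exp i + unit_exp i = a" and b: "b - unit_exp i + unit_exp i = b"
      using that by (auto intro!: exponent_diff_unit simp del: One_nat_def)
    then have "Suc (total_degree (a - unit_exp i)) = k"
      using that by (metis Suc_eq_plus1 total_degree_add total_degree_single)
    from sym[OF this, of "b + unit_exp j" i j] have
      "T a (b + unit_exp j - unit_exp j) = T (a - unit_exp i + unit_exp j) (b + unit_exp j - unit_exp i)"
      using a that by (simp add: T'_def lookup_add)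
    moreover have "b + unit_exp j - unit_exp i = b - unit_exp i + unit_exp j"
      using that by (intro poly_mapping_eqI) (auto simp: lookup_add lookup_minus lookup_single when_def)
    ultimately show ?thesis by simp
  qed
  \<comment> \<open>Moving units away from \<open>i\<close> preserves \<open>b\<^sub>i < a\<^sub>i\<close>, until \<open>b\<^sub>i = 0\<close> and the entry vanishes.\<close>
  have off: "T a b = 0"
    if "total_degree a = k" "total_degree b = k" "Poly_Mapping.lookup b i < Poly_Mapping.lookup a i" for a b i
    using that
  proof (induction "Poly_Mapping.lookup b i" arbitrary: a b)
    case 0
    then show ?case by (intro vanish[of a b i]) auto
  next
    case (Suc n)
    have nz: "Poly_Mapping.lookup b i \<noteq> 0" "Poly_Mapping.lookup a i \<noteq> 0" using Suc by auto
    obtain j where j: "i \<noteq> j" using other by metis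
    have "T (a - unit_exp i + unit_exp j) (b - unit_exp i + unit_exp j) = 0"
    proof (rule Suc.hyps(1))
      show "n = Poly_Mapping.lookup (b - unit_exp i + unit_exp j) i"
        using Suc.hyps(2) nz j unit_exp_diff_swap[of i j b i] by simp
      show "Poly_Mapping.lookup (b - unit_exp i + unit_exp j) i
          < Poly_Mapping.lookup (a - unit_exp i + unit_exp j) i"
        using Suc.prems nz j unit_exp_diff_swap[of i j b i] unit_exp_diff_swap[of i j a i] by simp
    qed (use Suc.prems nz in \<open>metis total_degree_swap\<close>)+
    then show ?case using move[of a b i j] Suc.prems nz by simp
  qed
  have off: "T a b = 0" if "total_degree a = k" "total_degree b = k" "a \<noteq> b" for a b
  proof -
    have "\<exists>i. Poly_Mapping.lookup b i < Poly_Mapping.lookup a i"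
    proof (rule ccontr)
      assume "\<not> ?thesis"
      then have le: "\<And>i. Poly_Mapping.lookup a i \<le> Poly_Mapping.lookup b i" by (auto simp: not_less)
      have "(\<Sum>i\<in>UNIV. Poly_Mapping.lookup a i) = (\<Sum>i\<in>UNIV. Poly_Mapping.lookup b i)"
        using that unfolding total_degree_def by simp
      then have "Poly_Mapping.lookup a i = Poly_Mapping.lookup b i" for i
        by (rule sum_mono_inv) (use le in auto)
      then show False using that by (auto intro: poly_mapping_eqI)
    qed
    then show ?thesis using off that by blast
  qed
  \<comment> \<open>All units of a diagonal index can be moved to one fixed variable.\<close>
  define o0 :: 'v where "o0 = undefined"
  define c where "c = T (Poly_Mapping.single o0 k) (Poly_Mapping.single o0 k)"
  have diag: "T a a = c" if "total_degree a = k" for a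
    using that
  proof (induction "k - Poly_Mapping.lookup a o0" arbitrary: a)
    case 0
    have "total_degree a = Poly_Mapping.lookup a o0 + (\<Sum>v\<in>UNIV - {o0}. Poly_Mapping.lookup a v)"
      unfolding total_degree_def by (subst sum.remove[of _ o0]) auto
    then have "Poly_Mapping.lookup a o0 = k" "\<forall>v\<in>UNIV - {o0}. Poly_Mapping.lookup a v = 0"
      using 0 by auto
    then have "a = Poly_Mapping.single o0 k"
      by (intro poly_mapping_eqI) (auto simp: lookup_single when_def)
    then show ?case by (simp add: c_def)
  next
    case (Suc n)
    have "\<exists>i. i \<noteq> o0 \<and> Poly_Mapping.lookup a i \<noteq> 0"
    proof (rule ccontr)
      assume "\<not> ?thesis"
      then have "total_degree a = (\<Sum>v\<in>UNIV. if v = o0 then Poly_Mapping.lookup a o0 else 0)"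
        unfolding total_degree_def by (intro sum.cong) auto
      then show False using Suc by simp
    qed
    then obtain i where i: "i \<noteq> o0" "Poly_Mapping.lookup a i \<noteq> 0" by blast
    have "T (a - unit_exp i + unit_exp o0) (a - unit_exp i + unit_exp o0) = c"
      using Suc i total_degree_swap[OF i(2), of o0] unit_exp_diff_swap[OF i, of o0]
      by (intro Suc.hyps(1)) auto
    then show ?case using move[of a a i o0] Suc.prems i by simp
  qed
  have "H m = c * G m" if m: "total_degree m \<ge> k" for m
  proof -
    have "\<exists>n a. m = n + a \<and> total_degree a = k" if "total_degree m = k + l" for l m
      using that
    proof (induction l arbitrary: m)
      case 0
      then show ?case by (intro exI[of _ 0] exI[of _ m]) simp
    next
      case (Suc l)
      then have "total_degree m = Suc (k + l)" by simp
      from total_degree_cases_unit[OF this] obtain v m' where m': "m = m' + unit_exp v" "total_degree m' = k + l" .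
      with Suc.IH obtain n a where "m' = n + a" "total_degree a = k" by blast
      with m' show ?case by (intro exI[of _ "n + unit_exp v"] exI[of _ a]) (simp add: add_ac)
    qed
    with m obtain n a where na: "m = n + a" "total_degree a = k" by (metis le_add_diff_inverse)
    have "H m = (\<Sum>b\<in>exponents k. T a b * G (n + b))" using T na by simp
    also have "\<dots> = (\<Sum>b\<in>exponents k. if a = b then c * G (n + b) else 0)"
      using off na diag by (intro sum.cong) auto
    also have "\<dots> = c * G m" using na by simp
    finally show ?thesis .
  qed
  then show ?thesis by blast
qed

section \<open>Generic forms have independent partial derivatives\<close>

lemma base_representation_unique:
  fixes a b :: "nat \<Rightarrow> nat"
  assumes "\<And>i. i < n \<Longrightarrow> a i < B" "\<And>i. i < n \<Longrightarrow> b i < B"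
    and "(\<Sum>i<n. a i * B ^ i) = (\<Sum>i<n. b i * B ^ i)" "i < n"
  shows "a i = b i"
  using assms
proof (induction n arbitrary: a b i)
  case (Suc n)
  have split: "(\<Sum>i<Suc n. c i * B ^ i) = c 0 + B * (\<Sum>i<n. c (Suc i) * B ^ i)" for c :: "nat \<Rightarrow> nat"
    by (simp add: sum.lessThan_Suc_shift sum_distrib_left mult_ac del: sum.lessThan_Suc)
  have B: "B > 0" using Suc.prems(1)[of 0] by simp
  have eq: "a 0 + B * (\<Sum>i<n. a (Suc i) * B ^ i) = b 0 + B * (\<Sum>i<n. b (Suc i) * B ^ i)"
    using Suc.prems(3) unfolding split .
  have "a 0 mod B = b 0 mod B" using arg_cong[OF eq, of "\<lambda>x. x mod B"] by simp
  then have 0: "a 0 = b 0" using Suc.prems by simp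
  then have "(\<Sum>i<n. a (Suc i) * B ^ i) = (\<Sum>i<n. b (Suc i) * B ^ i)" using eq B by simp
  then have "a (Suc j) = b (Suc j)" if "j < n" for j
    using Suc.prems(1,2) that by (intro Suc.IH[of "\<lambda>i. a (Suc i)" "\<lambda>i. b (Suc i)"]) auto
  with 0 show ?case using Suc.prems(4) by (cases i) auto
qed simp

text \<open>
  Kronecker's substitution: an additive weight that separates the exponent vectors of degree \<open>a\<close>
  is obtained by reading a vector as the list of its digits in base \<open>a + 1\<close>.
\<close>
lemma exponent_weight_exists:
  obtains w :: "('v::finite \<Rightarrow>\<^sub>0 nat) \<Rightarrow> nat"
  where "\<And>m n. w (m + n) = w m + w n" "inj_on w (exponents a)"
proof -
  obtain idx :: "'v \<Rightarrow> nat" where idx: "bij_betw idx UNIV {..<CARD('v)}"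
    using ex_bij_betw_finite_nat[of "UNIV :: 'v set"] by (auto simp: atLeast0LessThan)
  define nm where "nm = inv_into UNIV idx"
  have nm: "bij_betw nm {..<CARD('v)} UNIV" unfolding nm_def by (rule bij_betw_inv_into[OF idx])
  define w where "w m = (\<Sum>i<CARD('v). Poly_Mapping.lookup m (nm i) * (a + 1) ^ i)"
    for m :: "'v \<Rightarrow>\<^sub>0 nat"
  have le: "Poly_Mapping.lookup m v < a + 1" if "total_degree m = a" for m :: "'v \<Rightarrow>\<^sub>0 nat" and v
  proof -
    have "Poly_Mapping.lookup m v \<le> (\<Sum>v\<in>UNIV. Poly_Mapping.lookup m v)"
      by (rule member_le_sum) auto
    then show ?thesis using that by (simp add: total_degree_def)
  qed
  have "inj_on w (exponents a)"
  proof (rule inj_onI)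
    fix m n :: "'v \<Rightarrow>\<^sub>0 nat" assume mn: "m \<in> exponents a" "n \<in> exponents a" "w m = w n"
    have "Poly_Mapping.lookup m (nm i) = Poly_Mapping.lookup n (nm i)" if "i < CARD('v)" for i
      by (rule base_representation_unique[OF _ _ mn(3)[unfolded w_def] that])
        (use le mn in auto)
    moreover have "\<exists>i<CARD('v). v = nm i" for v
      using nm by (metis bij_betw_apply bij_betw_imp_surj_on imageE lessThan_iff UNIV_I)
    ultimately show "m = n" by (metis poly_mapping_eqI)
  qed
  moreover have "w (m + n) = w m + w n" for m n
    by (simp add: w_def lookup_add distrib_right sum.distrib)
  ultimately show ?thesis using that by blast
qed

text \<open>
  The matrix \<open>(\<Sum>s. s ^ (w a + w b + r))\<close> is the Gram matrix of the monomials \<open>t ^ w b\<close> for the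
  measure that gives the point \<open>s \<in> {1..N}\<close> the mass \<open>s\<^sup>r > 0\<close>. A vector \<open>c\<close> in its kernel thus
  defines a polynomial \<open>(\<Sum>b. c b * t ^ w b)\<close> of norm zero. It vanishes at the \<open>N\<close> points, which are
  more than its degree, and its coefficients are the \<open>c b\<close> because \<open>w\<close> is injective.
\<close>
lemma moments_independent:
  fixes w :: "'e \<Rightarrow> nat" and r :: nat
  assumes S: "finite S" and w: "inj_on w S" and N: "\<And>b. b \<in> S \<Longrightarrow> w b < N"
    and c: "\<And>a. a \<in> S \<Longrightarrow> (\<Sum>b\<in>S. (\<Sum>s=1..N. of_nat s ^ (w a + w b + r)) * c b) = (0::complex)"
    and b: "b \<in> S"
  shows "c b = 0"
proof -
  define P where "P s = (\<Sum>b\<in>S. c b * of_nat s ^ w b)" for s :: nat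
  have "(\<Sum>s=1..N. of_nat s ^ r * (cnj (P s) * P s)) =
      (\<Sum>s=1..N. \<Sum>a\<in>S. \<Sum>b\<in>S. cnj (c a) * (of_nat s ^ (w a + w b + r) * c b))"
    by (intro sum.cong)
      (simp_all add: P_def sum_product sum_distrib_left power_add mult_ac)
  also have "\<dots> = (\<Sum>a\<in>S. \<Sum>b\<in>S. \<Sum>s=1..N. cnj (c a) * (of_nat s ^ (w a + w b + r) * c b))"
    by (subst sum.swap) (intro sum.cong refl sum.swap)
  also have "\<dots> = (\<Sum>a\<in>S. cnj (c a) * (\<Sum>b\<in>S. (\<Sum>s=1..N. of_nat s ^ (w a + w b + r)) * c b))"
    by (simp add: sum_distrib_left sum_distrib_right)
  also have "\<dots> = 0" using c by simp
  finally have "(\<Sum>s=1..N. of_nat s ^ r * (cnj (P s) * P s)) = 0" .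
  moreover have "of_nat s ^ r * (cnj (P s) * P s) = complex_of_real (real s ^ r * (cmod (P s))\<^sup>2)" for s
    using complex_norm_square[of "P s"] by (simp add: mult.commute)
  ultimately have "complex_of_real (\<Sum>s=1..N. real s ^ r * (cmod (P s))\<^sup>2) = 0"
    by (simp only: of_real_sum)
  then have "(\<Sum>s=1..N. real s ^ r * (cmod (P s))\<^sup>2) = 0" by (simp only: of_real_eq_0_iff)
  then have "\<forall>s\<in>{1..N}. real s ^ r * (cmod (P s))\<^sup>2 = 0"
    by (subst (asm) sum_nonneg_eq_0_iff) auto
  then have root: "P s = 0" if "s \<in> {1..N}" for s using that by fastforce
  define Q where "Q = (\<Sum>b\<in>S. Polynomial.monom (c b) (w b))"
  have poly_Q: "poly Q (of_nat s) = P s" for s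
    by (simp add: Q_def P_def poly_sum poly_monom)
  have "Q = 0"
  proof (rule ccontr)
    assume Q: "Q \<noteq> 0"
    have "Polynomial.degree Q \<le> N - 1"
      unfolding Q_def using N
      by (intro degree_sum_le S order.trans[OF degree_monom_le]) fastforce
    moreover have "N > 0" using N[OF b] by simp
    ultimately have "Polynomial.degree Q < N" by simp
    moreover have "card {x. poly Q x = 0} \<le> Polynomial.degree Q"
      by (rule card_poly_roots_bound[OF Q])
    moreover have "card ((of_nat :: nat \<Rightarrow> complex) ` {1..N}) \<le> card {x. poly Q x = 0}"
      using root poly_Q poly_roots_finite[OF Q] by (intro card_mono) auto
    moreover have "card ((of_nat :: nat \<Rightarrow> complex) ` {1..N}) = N"
      by (subst card_image) (auto simp: inj_on_def)
    ultimately show False by simp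
  qed
  have "Polynomial.coeff Q (w b) = (\<Sum>b'\<in>S. if b = b' then c b' else 0)"
    unfolding Q_def Polynomial.coeff_sum
    using b w by (intro sum.cong) (auto simp: inj_on_def)
  then show ?thesis using S b \<open>Q = 0\<close> by simp
qed

text \<open>
  The index set of the matrix is the entries of a list, since the exponent vectors of a given degree
  do not form a type.
\<close>
lemma det_nonzero_iff:
  fixes K :: "'e \<Rightarrow> 'e \<Rightarrow> 'f::field"
  assumes xs: "distinct xs"
  shows "Determinant.det (Matrix.mat (length xs) (length xs) (\<lambda>(i, j). K (xs ! i) (xs ! j))) \<noteq> 0
    \<longleftrightarrow> (\<forall>c. (\<forall>x\<in>set xs. (\<Sum>y\<in>set xs. K x y * c y) = 0) \<longrightarrow> (\<forall>y\<in>set xs. c y = 0))"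
    (is "Determinant.det ?M \<noteq> 0 \<longleftrightarrow> ?R")
proof -
  let ?N = "length xs"
  have M: "?M \<in> carrier_mat ?N ?N" by simp
  have sum: "(\<Sum>j<?N. h (xs ! j)) = (\<Sum>y\<in>set xs. h y)" for h :: "'e \<Rightarrow> 'f"
    using sum.reindex_bij_betw[OF bij_betw_nth[OF xs, of "{..<?N}" "set xs"], of h] by auto
  have Mv: "vec_index (?M *\<^sub>v Matrix.vec ?N (\<lambda>j. c (xs ! j))) i = (\<Sum>y\<in>set xs. K (xs ! i) y * c y)"
    if "i < ?N" for i c
    using that by (simp add: scalar_prod_def sum[of "\<lambda>y. K (xs ! i) y * c y", symmetric] atLeast0LessThan)
  show ?thesis
  proof
    assume det: "Determinant.det ?M \<noteq> 0"
    show ?R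
    proof (intro allI impI ballI)
      fix c y assume c: "\<forall>x\<in>set xs. (\<Sum>y\<in>set xs. K x y * c y) = 0" and y: "y \<in> set xs"
      let ?v = "Matrix.vec ?N (\<lambda>j. c (xs ! j))"
      have "?M *\<^sub>v ?v = 0\<^sub>v ?N"
      proof (rule eq_vecI)
        fix i assume "i < dim_vec (0\<^sub>v ?N :: 'f Matrix.vec)"
        then show "vec_index (?M *\<^sub>v ?v) i = vec_index (0\<^sub>v ?N) i"
          using Mv[of i c] c by simp
      qed simp
      moreover have "?v \<in> carrier_vec ?N" by simp
      ultimately have "?v = 0\<^sub>v ?N" using det det_0_iff_vec_prod_zero_field[OF M] by blast
      moreover obtain j where j: "j < ?N" "y = xs ! j" using y by (metis in_set_conv_nth)
      ultimately show "c y = 0" by (metis index_vec index_zero_vec(1))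
    qed
  next
    assume R: ?R
    show "Determinant.det ?M \<noteq> 0"
    proof
      assume "Determinant.det ?M = 0"
      then obtain v where v: "v \<in> carrier_vec ?N" "v \<noteq> 0\<^sub>v ?N" "?M *\<^sub>v v = 0\<^sub>v ?N"
        using det_0_iff_vec_prod_zero_field[OF M] by blast
      define c where "c y = vec_index v (inv_into {..<?N} ((!) xs) y)" for y
      have c: "c (xs ! j) = vec_index v j" if "j < ?N" for j
        unfolding c_def using that inj_on_nth[OF xs, of "{..<?N}"] by (subst inv_into_f_f) auto
      have vc: "v = Matrix.vec ?N (\<lambda>j. c (xs ! j))"
        using v c by (intro eq_vecI) auto
      have "(\<Sum>y\<in>set xs. K x y * c y) = 0" if x: "x \<in> set xs" for x
      proof -
        obtain i where i: "i < ?N" "x = xs ! i" using x by (metis in_set_conv_nth)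
        have "vec_index (?M *\<^sub>v Matrix.vec ?N (\<lambda>j. c (xs ! j))) i = 0"
          using v(3) i(1) vc by (metis index_zero_vec(1))
        then show ?thesis using Mv[OF i(1), of c] i(2) by simp
      qed
      then have "\<forall>y\<in>set xs. c y = 0" using R by blast
      then have "v = 0\<^sub>v ?N" using v(1) c by (intro eq_vecI) (auto simp flip: c)
      with v show False by simp
    qed
  qed
qed

lemma insertion_det:
  assumes "scalar_hom h"
  shows "insertion h a (Determinant.det M) = Determinant.det (map_mat (insertion h a) M)"
proof -
  interpret comm_ring_hom "insertion h a"
    using assms by unfold_locales (auto simp: insertion_add insertion_mult)
  show ?thesis by simp
qed

text \<open>
  The determinant is that of the block of the catalecticant matrix whose rows are the exponents
  \<open>x + e\<close> and whose columns are the exponents \<open>y\<close>, where \<open>x\<close> and \<open>y\<close> have degree \<open>a\<close> and the fixed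
  vector \<open>e\<close> fills up the degree to \<open>d\<close>. Its entries are linear in the coefficients of the form, so
  its determinant is a polynomial function on the space of forms.
\<close>
lemma generic_shift_independent:
  fixes a d :: nat
  assumes "2 * a \<le> d"
  obtains U :: "('v::finite) cpoly set" where "zariski_open d U" "U \<noteq> {}" "U \<subseteq> homogeneous d"
    "\<And>g. g \<in> U \<Longrightarrow> shift_independent a (divided_coeff g)"
proof -
  define e :: "'v \<Rightarrow>\<^sub>0 nat" where "e = Poly_Mapping.single undefined (d - 2 * a)"
  obtain xs :: "('v \<Rightarrow>\<^sub>0 nat) list" where xs: "set xs = exponents a" "distinct xs"
    using finite_distinct_list[OF finite_exponents] by blast
  let ?N = "length xs"
  define M :: "('v \<Rightarrow>\<^sub>0 nat) cpoly mat" where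
    "M = Matrix.mat ?N ?N (\<lambda>(i, j).
       const (\<Prod>v\<in>UNIV. fact (Poly_Mapping.lookup (xs ! i + xs ! j + e) v)) *
         var (xs ! i + xs ! j + e))"
  define F where "F = Determinant.det M"
  have F: "insertion id (Poly_Mapping.lookup g) F =
      Determinant.det (Matrix.mat ?N ?N (\<lambda>(i, j). divided_coeff g (xs ! i + xs ! j + e)))" for g
  proof -
    have "map_mat (insertion id (Poly_Mapping.lookup g)) M
        = Matrix.mat ?N ?N (\<lambda>(i, j). divided_coeff g (xs ! i + xs ! j + e))"
      unfolding M_def by (intro eq_matI) (auto simp: insertion_mult divided_coeff_def)
    then show ?thesis by (simp add: F_def insertion_det)
  qed
  have F_nz: "insertion id (Poly_Mapping.lookup g) F \<noteq> 0 \<longleftrightarrow>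
     (\<forall>c. (\<forall>x\<in>exponents a. (\<Sum>y\<in>exponents a. divided_coeff g (x + y + e) * c y) = 0) \<longrightarrow> (\<forall>y\<in>exponents a. c y = 0))" for g
    unfolding F using det_nonzero_iff[OF xs(2), of "\<lambda>x y. divided_coeff g (x + y + e)"] by (simp add: xs)
  define U where "U = homogeneous d - {f. \<forall>F\<in>{F}. insertion id (Poly_Mapping.lookup f) F = 0}"
  have "zariski_open d U" unfolding zariski_open_def U_def by blast
  moreover have "shift_independent a (divided_coeff g)" if "g \<in> U" for g
    unfolding shift_independent_def
  proof (intro allI impI)
    fix c assume c: "\<forall>m. (\<Sum>b\<in>exponents a. c b * divided_coeff g (m + b)) = 0"
    have "(\<Sum>y\<in>exponents a. divided_coeff g (x + y + e) * c y) = 0" for x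
      using c[rule_format, of "x + e"] by (simp add: add_ac mult.commute)
    then show "\<forall>b\<in>exponents a. c b = 0" using that F_nz[of g] by (simp add: U_def)
  qed
  moreover have "U \<noteq> {}"
  proof -
    obtain w :: "('v \<Rightarrow>\<^sub>0 nat) \<Rightarrow> nat" where w: "\<And>m n. w (m + n) = w m + w n" "inj_on w (exponents a)"
      using exponent_weight_exists[of a] by blast
    define N where "N = Suc (\<Sum>b\<in>(exponents a :: ('v \<Rightarrow>\<^sub>0 nat) set). w b)"
    have N: "w b < N" if "b \<in> exponents a" for b
      unfolding N_def less_Suc_eq_le using that by (intro member_le_sum) auto
    \<comment> \<open>The sums of the monomials \<open>x\<^sup>m\<close> over the points \<open>x\<close> with coordinates \<open>x\<^sub>v = s ^ w(e\<^sub>v)\<close>, \<open>s = 1, \<dots>, N\<close>.\<close>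
    define mom :: "('v \<Rightarrow>\<^sub>0 nat) \<Rightarrow> complex" where "mom m = (\<Sum>s=1..N. of_nat s ^ w m)" for m
    define f :: "'v cpoly" where "f = (\<Sum>m\<in>exponents d. Poly_Mapping.single m
        (mom m / (\<Prod>v\<in>UNIV. fact (Poly_Mapping.lookup m v))))"
    have lookup_f: "Poly_Mapping.lookup f m =
        (if total_degree m = d then mom m / (\<Prod>v\<in>UNIV. fact (Poly_Mapping.lookup m v)) else 0)" for m
      unfolding f_def lookup_sum lookup_single when_def by (subst sum.delta) auto
    have dp_f: "divided_coeff f m = mom m" if "total_degree m = d" for m
      using that by (simp add: divided_coeff_def lookup_f)
    have "f \<in> homogeneous d" by (simp add: homogeneous_iff lookup_f)
    moreover have "insertion id (Poly_Mapping.lookup f) F \<noteq> 0"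
      unfolding F_nz
    proof (intro allI impI ballI)
      fix c and y :: "'v \<Rightarrow>\<^sub>0 nat"
      assume c: "\<forall>x\<in>exponents a. (\<Sum>y\<in>exponents a. divided_coeff f (x + y + e) * c y) = 0" and y: "y \<in> exponents a"
      have orth: "(\<Sum>y\<in>exponents a. (\<Sum>s=1..N. of_nat s ^ (w x + w y + w e)) * c y) = 0" if x: "x \<in> exponents a" for x
      proof -
        have "(\<Sum>y\<in>exponents a. divided_coeff f (x + y + e) * c y)
            = (\<Sum>y\<in>exponents a. (\<Sum>s=1..N. of_nat s ^ (w x + w y + w e)) * c y)"
        proof (intro sum.cong refl)
          fix y :: "'v \<Rightarrow>\<^sub>0 nat" assume "y \<in> exponents a"
          then have "total_degree (x + y + e) = d" using x assms by (simp add: e_def)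
          then show "divided_coeff f (x + y + e) * c y = (\<Sum>s=1..N. of_nat s ^ (w x + w y + w e)) * c y"
            by (simp add: dp_f mom_def w(1))
        qed
        with c x show ?thesis by simp
      qed
      show "c y = 0"
      proof (rule moments_independent[where r = "w e", OF finite_exponents w(2) _ _ y])
        show "w x < N" if "x \<in> exponents a" for x using that by (rule N)
        show "(\<Sum>y\<in>exponents a. (\<Sum>s=1..N. of_nat s ^ (w x + w y + w e)) * c y) = 0"
          if "x \<in> exponents a" for x using that by (rule orth)
      qed
    qed
    ultimately show ?thesis by (auto simp: U_def)
  qed
  moreover have "U \<subseteq> homogeneous d" by (auto simp: U_def)
  ultimately show ?thesis using that by blast
qed

section \<open>Isomorphisms of Milnor algebras\<close>

lemma a_inv_poly_ring: "\<ominus>\<^bsub>poly_ring\<^esub> p = - (p :: 'v cpoly)"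
proof -
  interpret ring "poly_ring :: 'v cpoly ring" by (rule ring_from_type_algebra)
  show ?thesis by (rule minus_equality) (simp_all add: ring_of_type_algebra_def)
qed

lemma ideal_jacobian_ideal: "ideal (jacobian_ideal k (f :: 'v cpoly)) poly_ring"
  unfolding jacobian_ideal_def
  by (rule ring.genideal_ideal[OF ring_from_type_algebra]) (simp add: ring_of_type_algebra_def)

lemma partials_in_jacobian_ideal: "partials k (f :: 'v cpoly) \<subseteq> jacobian_ideal k f"
  unfolding jacobian_ideal_def
  by (rule ring.genideal_self[OF ring_from_type_algebra]) (simp add: ring_of_type_algebra_def)

lemma milnor_class_eq_iff:
  "milnor_class k (f :: 'v cpoly) p = milnor_class k f q \<longleftrightarrow> p - q \<in> jacobian_ideal k f"
proof -
  have "p \<ominus>\<^bsub>poly_ring\<^esub> q = p - q"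
    by (simp add: a_minus_def a_inv_poly_ring) (simp add: ring_of_type_algebra_def)
  then show ?thesis
    using ring.quotient_eq_iff_same_a_r_cos[OF ring_from_type_algebra ideal_jacobian_ideal, of p q k f]
    by (simp add: milnor_class_def ring_of_type_algebra_def)
qed

lemma milnor_class_in_carrier: "milnor_class k f p \<in> carrier (milnor_algebra k f)"
  and milnor_class_add: "milnor_class k f (p + q) =
      milnor_class k f p \<oplus>\<^bsub>milnor_algebra k f\<^esub> milnor_class k f q"
  and milnor_class_mult: "milnor_class k f (p * q) =
      milnor_class k f p \<otimes>\<^bsub>milnor_algebra k f\<^esub> milnor_class k f q"
proof -
  have hom: "milnor_class k f \<in> Ring.ring_hom poly_ring (milnor_algebra k f)"
    unfolding milnor_class_def[abs_def] milnor_algebra_def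
    by (rule ideal.rcos_ring_hom[OF ideal_jacobian_ideal])
  show "milnor_class k f p \<in> carrier (milnor_algebra k f)"
    using hom by (rule ring_hom_closed) (simp add: ring_of_type_algebra_def)
  show "milnor_class k f (p + q) = milnor_class k f p \<oplus>\<^bsub>milnor_algebra k f\<^esub> milnor_class k f q"
    using ring_hom_add[OF hom, of p q] by (simp add: ring_of_type_algebra_def)
  show "milnor_class k f (p * q) = milnor_class k f p \<otimes>\<^bsub>milnor_algebra k f\<^esub> milnor_class k f q"
    using ring_hom_mult[OF hom, of p q] by (simp add: ring_of_type_algebra_def)
qed

lemma lookup_var_mult:
  "Poly_Mapping.lookup (var v * p) m =
    (if Poly_Mapping.lookup m v = 0 then 0 else Poly_Mapping.lookup p (m - unit_exp v))"
proof (induction p rule: poly_mapping_single_induct)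
  case (single_add n c q)
  have "Poly_Mapping.lookup (var v * Poly_Mapping.single n c) m =
    (if Poly_Mapping.lookup m v = 0 then 0
     else Poly_Mapping.lookup (Poly_Mapping.single n c) (m - unit_exp v))"
  proof (cases "Poly_Mapping.lookup m v = 0")
    case True
    then have "unit_exp v + n \<noteq> m" by (auto simp: lookup_add)
    with True show ?thesis by (simp add: var_def mult_single lookup_single when_def)
  next
    case False
    then have "unit_exp v + n = m \<longleftrightarrow> n = m - unit_exp v"
      using exponent_diff_unit[OF False] by (metis add.commute add_diff_cancel_left')
    with False show ?thesis by (simp add: var_def mult_single lookup_single when_def)
  qed
  with single_add show ?case by (simp add: distrib_left lookup_add)
qed simp

text \<open>
  The generators of \<open>J\<^sup>k(g)\<close> are forms of degree \<open>d - k\<close>, hence an element of the ideal has no terms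
  of lower degree, and its component of degree \<open>d - k\<close> is a combination of the generators with
  constant coefficients. The proof checks that the polynomials with these two properties form an
  ideal; closure under multiplication is clear for constants, and multiplication by a variable moves
  every term above degree \<open>d - k\<close>.
\<close>
lemma jacobian_ideal_lowest_degree:
  assumes g: "g \<in> homogeneous d" and p: "p \<in> jacobian_ideal k g"
  shows "\<And>m. total_degree m < d - k \<Longrightarrow> Poly_Mapping.lookup p m = 0"
    and "\<exists>c. \<forall>m. total_degree m = d - k \<longrightarrow> divided_coeff p m = (\<Sum>b\<in>exponents k. c b * divided_coeff g (m + b))"
proof -
  define low where "low p \<longleftrightarrow> (\<forall>m. total_degree m < d - k \<longrightarrow> Poly_Mapping.lookup p m = 0)"
    for p :: "'a cpoly"
  define spn where "spn p \<longleftrightarrow> (\<exists>c. \<forall>m. total_degree m = d - k \<longrightarrow>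
      divided_coeff p m = (\<Sum>b\<in>exponents k. c b * divided_coeff g (m + b)))" for p :: "'a cpoly"
  define I where "I = {p. low p \<and> spn p}"
  have zero: "0 \<in> I"
    unfolding I_def low_def spn_def by (auto intro: exI[of _ "\<lambda>_. 0"])
  have add: "p + q \<in> I" if pq: "p \<in> I" "q \<in> I" for p q
  proof -
    obtain c c' where "\<forall>m. total_degree m = d - k \<longrightarrow> divided_coeff p m = (\<Sum>b\<in>exponents k. c b * divided_coeff g (m + b))"
      "\<forall>m. total_degree m = d - k \<longrightarrow> divided_coeff q m = (\<Sum>b\<in>exponents k. c' b * divided_coeff g (m + b))"
      using pq unfolding I_def spn_def by blast
    then have "spn (p + q)" unfolding spn_def
      by (intro exI[of _ "\<lambda>b. c b + c' b"]) (simp add: divided_coeff_add distrib_right sum.distrib)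
    then show ?thesis using pq unfolding I_def low_def by (simp add: lookup_add)
  qed
  have mult: "r * p \<in> I" if "p \<in> I" for r p
    using that
  proof (induction r arbitrary: p rule: cpoly_induct)
    case (const a)
    then obtain c where "\<forall>m. total_degree m = d - k \<longrightarrow> divided_coeff p m = (\<Sum>b\<in>exponents k. c b * divided_coeff g (m + b))"
      unfolding I_def spn_def by blast
    then have "spn (const a * p)" unfolding spn_def
      by (intro exI[of _ "\<lambda>b. a * c b"]) (simp add: divided_coeff_const_mult sum_distrib_left mult.assoc)
    then show ?case using const unfolding I_def low_def by (simp add: lookup_const_mult)
  next
    case (var v)
    have "Poly_Mapping.lookup (var v * p) m = 0" if m: "total_degree m \<le> d - k" for m
    proof (cases "Poly_Mapping.lookup m v = 0")
      case False
      then have "total_degree (m - unit_exp v) + 1 = total_degree m"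
        by (metis exponent_diff_unit total_degree_add total_degree_single)
      then show ?thesis using var m unfolding I_def low_def by (simp add: lookup_var_mult)
    qed (simp add: lookup_var_mult)
    then show ?case unfolding I_def low_def spn_def
      by (auto intro!: exI[of _ "\<lambda>_. 0"] simp: divided_coeff_eq_0_iff)
  next
    case (add r s)
    then show ?case by (simp add: distrib_right \<open>\<And>q p. p \<in> I \<Longrightarrow> q \<in> I \<Longrightarrow> p + q \<in> I\<close>)
  next
    case (mult r s)
    then show ?case by (simp add: mult.assoc)
  qed
  have "ideal I (poly_ring :: 'a cpoly ring)"
  proof (rule idealI)
    show "subgroup I (add_monoid (poly_ring :: 'a cpoly ring))"
    proof (rule subgroup.intro)
      fix q assume q: "q \<in> I"
      have "- q \<in> I" using mult[OF q, of "- 1"] by simp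
      then show "inv\<^bsub>add_monoid (poly_ring :: 'a cpoly ring)\<^esub> q \<in> I"
        using a_inv_poly_ring[of q] by (simp add: a_inv_def)
    qed (use zero add in \<open>auto simp: ring_of_type_algebra_def\<close>)
  next
    show "ring (poly_ring :: 'a cpoly ring)" by (rule ring_from_type_algebra)
  qed (use mult in \<open>auto simp: ring_of_type_algebra_def mult.commute\<close>)
  moreover have "partials k g \<subseteq> I"
  proof
    fix q assume "q \<in> partials k g"
    then obtain vs where q: "q = foldr partial vs g" "length vs = k" by (auto simp: partials_def)
    have "q \<in> homogeneous (d - k)" using foldr_partial_homogeneous[OF g, of vs] q by simp
    then have "low q" by (auto simp: low_def homogeneous_iff)
    moreover have "spn q" unfolding spn_def
    proof (intro exI allI impI)
      fix m
      have "(\<Sum>b\<in>exponents k. (if exponent_of vs = b then 1 else 0) * divided_coeff g (m + b))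
          = (\<Sum>b\<in>exponents k. if exponent_of vs = b then divided_coeff g (m + b) else 0)"
        by (intro sum.cong) auto
      then show "divided_coeff q m
          = (\<Sum>b\<in>exponents k. (if exponent_of vs = b then 1 else 0) * divided_coeff g (m + b))"
        using q by (simp add: divided_coeff_partials total_degree_exponent_of)
    qed
    ultimately show "q \<in> I" by (simp add: I_def)
  qed
  ultimately have "jacobian_ideal k g \<subseteq> I"
    unfolding jacobian_ideal_def by (rule ring.genideal_minimal[OF ring_from_type_algebra])
  then have "p \<in> I" using p by blast
  then show "\<And>m. total_degree m < d - k \<Longrightarrow> Poly_Mapping.lookup p m = 0"
    and "\<exists>c. \<forall>m. total_degree m = d - k \<longrightarrow> divided_coeff p m = (\<Sum>b\<in>exponents k. c b * divided_coeff g (m + b))"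
    by (auto simp: I_def low_def spn_def)
qed

lemma total_degree_eq_1: "total_degree m = 1 \<longleftrightarrow> (\<exists>v. m = unit_exp v)"
proof
  assume "total_degree m = 1"
  then have "total_degree m = Suc 0" by simp
  from total_degree_cases_unit[OF this] show "\<exists>v. m = unit_exp v" by (metis add_0 total_degree_eq_0)
qed auto

lemma unit_exp_eq_iff: "unit_exp v = unit_exp w \<longleftrightarrow> v = w"
  by (metis lookup_single_eq lookup_single_not_eq zero_neq_one)

lemma lookup_var_unit_exp: "Poly_Mapping.lookup (var v) (unit_exp w) = (if v = w then 1 else 0)"
  by (simp add: var_def lookup_single when_def unit_exp_eq_iff del: One_nat_def)

lemma lookup_linear_form: "Poly_Mapping.lookup (linear_form A v) (unit_exp w) = vec_nth (vec_nth A v) w"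
proof -
  have "Poly_Mapping.lookup (linear_form A v) (unit_exp w)
      = (\<Sum>u\<in>UNIV. if w = u then vec_nth (vec_nth A v) u else 0)"
    unfolding linear_form_def lookup_sum
    by (intro sum.cong) (auto simp: lookup_const_mult lookup_var_unit_exp simp del: One_nat_def)
  then show ?thesis by simp
qed

lemma homogeneous_1_linear_form:
  assumes "\<And>v. l v \<in> homogeneous 1"
  obtains A where "l = linear_form A"
proof
  define A where "A = (\<chi> v w. Poly_Mapping.lookup (l v) (unit_exp w))"
  show "l = linear_form A"
  proof (intro ext poly_mapping_eqI)
    fix v m
    show "Poly_Mapping.lookup (l v) m = Poly_Mapping.lookup (linear_form A v) m"
    proof (cases "total_degree m = 1")
      case True
      then obtain w where "m = unit_exp w" by (auto simp only: total_degree_eq_1)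
      then show ?thesis by (simp only: lookup_linear_form) (simp add: A_def)
    next
      case False
      then show ?thesis
        using assms[of v] homogeneous_linear_form[of A v] unfolding homogeneous_iff by metis
    qed
  qed
qed

text \<open>
  The isomorphism maps degree one to degree one, which defines \<open>A\<close>. It is then induced by the
  substitution \<open>A\<close>, because both are ring homomorphisms that agree on constants and variables. A
  linear relation between the rows of \<open>A\<close> would put a linear form into \<open>J\<^sup>k(f)\<close>, which has no elements
  of degree less than \<open>d - k \<ge> 2\<close>; hence \<open>A\<close> is invertible.
\<close>
lemma milnor_isomorphic_imp_linear_subst:
  fixes f g :: "('v::finite) cpoly"
  assumes d: "k + 2 \<le> d" and f: "f \<in> homogeneous d" and iso: "milnor_isomorphic k f g"
  obtains A where "invertible A" "\<And>p. p \<in> jacobian_ideal k f \<Longrightarrow> linear_subst A p \<in> jacobian_ideal k g"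
proof -
  obtain \<phi> where \<phi>: "\<phi> \<in> ring_iso (milnor_algebra k f) (milnor_algebra k g)"
    and const: "\<And>c. \<phi> (milnor_class k f (const c)) = milnor_class k g (const c)"
    and piece: "\<And>i. \<phi> ` milnor_graded_piece k f i = milnor_graded_piece k g i"
    using iso unfolding milnor_isomorphic_def by blast
  have "\<exists>l \<in> homogeneous 1. \<phi> (milnor_class k f (var v)) = milnor_class k g l" for v
  proof -
    have "\<phi> (milnor_class k f (var v)) \<in> milnor_graded_piece k g 1"
      by (metis homogeneous_var imageI milnor_graded_piece_def piece)
    then show ?thesis unfolding milnor_graded_piece_def by blast
  qed
  then obtain l where l: "\<And>v. l v \<in> homogeneous 1"
    "\<And>v. \<phi> (milnor_class k f (var v)) = milnor_class k g (l v)" by metis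
  obtain A where A: "l = linear_form A" using homogeneous_1_linear_form[OF l(1)] .
  have lift: "\<phi> (milnor_class k f p) = milnor_class k g (linear_subst A p)" for p
  proof (induction p rule: cpoly_induct)
    case (const c)
    then show ?case by (simp add: \<open>\<And>c. \<phi> (milnor_class k f (const c)) = milnor_class k g (const c)\<close>)
  next
    case (var v)
    then show ?case using l(2) A by simp
  next
    case (add p q)
    then show ?case
      by (simp add: milnor_class_add linear_subst_add milnor_class_in_carrier ring_iso_memE(3)[OF \<phi>])
  next
    case (mult p q)
    then show ?case
      by (simp add: milnor_class_mult linear_subst_mult milnor_class_in_carrier ring_iso_memE(2)[OF \<phi>])
  qed
  have inj: "p - q \<in> jacobian_ideal k f" if "linear_subst A p = linear_subst A q" for p q
  proof -
    have "\<phi> (milnor_class k f p) = \<phi> (milnor_class k f q)" using that by (simp add: lift)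
    moreover have "inj_on \<phi> (carrier (milnor_algebra k f))"
      using ring_iso_memE(5)[OF \<phi>] by (rule bij_betw_imp_inj_on)
    ultimately have "milnor_class k f p = milnor_class k f q"
      using milnor_class_in_carrier by (metis inj_onD)
    then show ?thesis by (simp only: milnor_class_eq_iff)
  qed
  have "\<exists>B. A ** B = Finite_Cartesian_Product.mat 1"
    unfolding matrix_right_invertible_independent_rows
  proof (intro allI impI)
    fix b v assume b: "(\<Sum>i\<in>UNIV. b i *s Finite_Cartesian_Product.row i A) = 0"
    define p where "p = (\<Sum>v\<in>UNIV. const (b v) * var v)"
    have "(\<Sum>v\<in>UNIV. b v * vec_nth (vec_nth A v) w) = 0" for w
      using arg_cong[OF b, of "\<lambda>x. vec_nth x w"] by (simp add: Finite_Cartesian_Product.row_def)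
    moreover have "linear_subst A p
        = (\<Sum>w\<in>UNIV. const (\<Sum>v\<in>UNIV. b v * vec_nth (vec_nth A v) w) * var w)"
      unfolding p_def linear_subst_sum linear_subst_mult
      by (simp add: linear_form_def sum_distrib_left const_sum sum_distrib_right const_mult mult.assoc)
        (rule sum.swap)
    ultimately have "linear_subst A p = linear_subst A 0" by simp
    from inj[OF this] have "p \<in> jacobian_ideal k f" by simp
    then have "Poly_Mapping.lookup p (unit_exp v) = 0"
      by (rule jacobian_ideal_lowest_degree(1)[OF f]) (use d in simp)
    moreover have "Poly_Mapping.lookup p (unit_exp v) = (\<Sum>u\<in>UNIV. if v = u then b u else 0)"
      unfolding p_def lookup_sum
      by (intro sum.cong) (auto simp: lookup_const_mult lookup_var_unit_exp simp del: One_nat_def)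
    ultimately show "b v = 0" by simp
  qed
  then have "invertible A" by (simp add: invertible_right_inverse)
  moreover have "linear_subst A p \<in> jacobian_ideal k g" if "p \<in> jacobian_ideal k f" for p
  proof -
    have "milnor_class k f p = milnor_class k f 0" using that by (simp add: milnor_class_eq_iff)
    then have "milnor_class k g (linear_subst A p) = milnor_class k g 0"
      using lift[of p] lift[of 0] by simp
    then show ?thesis by (simp add: milnor_class_eq_iff)
  qed
  ultimately show ?thesis using that by blast
qed

section \<open>Recovering a generic form\<close>

text \<open>
  The inclusion of ideals, in degree \<open>d - k\<close>, says that the transformed partials of \<open>f\<close> are
  combinations of the partials of \<open>g\<close>. By the chain rule the same is true of the partials of the
  transformed \<open>f\<close>, and \<open>shift_span_scalar\<close> applies. It compares the coefficients of degree at least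
  \<open>k\<close> only, which include those of degree \<open>d\<close>.
\<close>
lemma linear_subst_eq_const_mult:
  fixes f g :: "('v::finite) cpoly"
  assumes two: "CARD('v) \<ge> 2" and k: "1 \<le> k" "k \<le> d"
    and f: "f \<in> homogeneous d" and g: "g \<in> homogeneous d"
    and indep: "shift_independent (Suc k) (divided_coeff g)"
    and J: "\<And>p. p \<in> jacobian_ideal k f \<Longrightarrow> linear_subst A p \<in> jacobian_ideal k g"
  shows "\<exists>c. linear_subst A f = const c * g"
proof -
  define h where "h = linear_subst A f"
  have h: "h \<in> homogeneous d" unfolding h_def by (rule homogeneous_linear_subst[OF f])
  \<comment> \<open>The span of the partials of order \<open>k\<close> of \<open>g\<close>.\<close>
  define W where "W = {q. \<exists>c. \<forall>m. divided_coeff q m = (\<Sum>b\<in>exponents k. c b * divided_coeff g (m + b))}"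
  have W: "q \<in> W" if q: "q \<in> partials k h" for q
  proof (rule partials_linear_subst_mem[OF _ _ _ q[unfolded h_def]])
    fix F :: "'v \<Rightarrow> 'v cpoly" assume "\<And>v. F v \<in> W"
    then obtain c where "\<And>v m. divided_coeff (F v) m = (\<Sum>b\<in>exponents k. c v b * divided_coeff g (m + b))"
      unfolding W_def mem_Collect_eq by metis
    then have "divided_coeff (\<Sum>v\<in>UNIV. F v) m
        = (\<Sum>b\<in>exponents k. (\<Sum>v\<in>UNIV. c v b) * divided_coeff g (m + b))" for m
      by (simp add: divided_coeff_sum sum_distrib_right) (rule sum.swap)
    then show "(\<Sum>v\<in>UNIV. F v) \<in> W"
      unfolding W_def mem_Collect_eq by (intro exI[of _ "\<lambda>b. \<Sum>v\<in>UNIV. c v b"]) blast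
  next
    fix a p assume "p \<in> W"
    then obtain c where "\<And>m. divided_coeff p m = (\<Sum>b\<in>exponents k. c b * divided_coeff g (m + b))"
      unfolding W_def by blast
    then show "const a * p \<in> W"
      unfolding W_def
      by (auto intro!: exI[of _ "\<lambda>b. a * c b"]
          simp: divided_coeff_const_mult sum_distrib_left mult.assoc)
  next
    fix p assume p: "p \<in> partials k f"
    then have "linear_subst A p \<in> jacobian_ideal k g"
      using J partials_in_jacobian_ideal by blast
    from jacobian_ideal_lowest_degree(2)[OF g this] obtain c where
      c: "\<And>m. total_degree m = d - k \<Longrightarrow>
        divided_coeff (linear_subst A p) m = (\<Sum>b\<in>exponents k. c b * divided_coeff g (m + b))" by blast
    have "p \<in> homogeneous (d - k)"
      using p foldr_partial_homogeneous[OF f] by (auto simp: partials_def)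
    then have hom: "linear_subst A p \<in> homogeneous (d - k)" by (rule homogeneous_linear_subst)
    have "divided_coeff (linear_subst A p) m = (\<Sum>b\<in>exponents k. c b * divided_coeff g (m + b))" for m
    proof (cases "total_degree m = d - k")
      case False
      then have "divided_coeff (linear_subst A p) m = 0"
        using hom by (simp add: homogeneous_iff divided_coeff_eq_0_iff)
      moreover have "divided_coeff g (m + b) = 0" if "b \<in> exponents k" for b
        using that False g k by (simp add: homogeneous_iff divided_coeff_eq_0_iff)
      ultimately show ?thesis by simp
    qed (rule c)
    then show "linear_subst A p \<in> W" unfolding W_def by blast
  qed
  have "\<exists>c. \<forall>m. divided_coeff h (m + a) = (\<Sum>b\<in>exponents k. c b * divided_coeff g (m + b))"
    if a: "total_degree a = k" for a
  proof -
    obtain vs where vs: "length vs = k" "exponent_of vs = a" using exponent_of_surj[OF a] .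
    then have "foldr partial vs h \<in> W" by (intro W) (auto simp: partials_def)
    then show ?thesis unfolding W_def by (simp add: divided_coeff_partials vs)
  qed
  then obtain c where c: "\<And>m. total_degree m \<ge> k \<Longrightarrow> divided_coeff h m = c * divided_coeff g m"
    using shift_span_scalar[OF two k(1) indep, of "divided_coeff h"] by blast
  have "h = const c * g"
  proof (rule divided_coeff_eqI)
    fix m show "divided_coeff h m = divided_coeff (const c * g) m"
    proof (cases "total_degree m = d")
      case True
      then show ?thesis using c[of m] k by (simp add: divided_coeff_const_mult)
    next
      case False
      then show ?thesis using h g by (simp add: divided_coeff_def lookup_const_mult homogeneous_iff)
    qed
  qed
  then show ?thesis unfolding h_def by blast
qed

lemma shift_independent_nonzero:
  assumes "shift_independent a (divided_coeff (f :: ('v::finite) cpoly))"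
  shows "f \<noteq> 0"
proof
  assume "f = 0"
  then have "(\<Sum>b\<in>exponents a. 1 * divided_coeff f (m + b)) = 0" for m by simp
  then have "\<forall>b\<in>(exponents a :: ('v \<Rightarrow>\<^sub>0 nat) set). (1::complex) = 0"
    using assms[unfolded shift_independent_def, THEN spec, of "\<lambda>_. 1"] by blast
  moreover have "Poly_Mapping.single undefined a \<in> (exponents a :: ('v \<Rightarrow>\<^sub>0 nat) set)"
    by simp
  ultimately show False by (metis one_neq_zero)
qed

lemma projectively_equivalent_if_const_mult:
  assumes f: "f \<in> homogeneous d" and d: "d > 0" and A: "invertible A"
    and eq: "linear_subst A f = const c * g" and c: "c \<noteq> 0"
  shows "projectively_equivalent f g"
proof -
  obtain s where s: "s ^ d = inverse c"
    using exists_complex_root[of d "inverse c"] d by (metis less_irrefl)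
  have s0: "s \<noteq> 0" using s c d by (auto simp: power_0_left)
  define A' where "A' = (\<chi> i j. s * vec_nth (vec_nth A i) j)"
  have "linear_subst A' f = const (inverse c) * (const c * g)"
    unfolding A'_def linear_subst_scale[OF f] s using eq by simp
  also have "\<dots> = g" using c by (simp flip: mult.assoc const_mult)
  finally have "g = linear_subst A' f" by simp
  moreover have "invertible A'"
  proof -
    obtain B where B: "A ** B = Finite_Cartesian_Product.mat 1"
      using A unfolding invertible_right_inverse by blast
    have "A' ** (\<chi> i j. inverse s * vec_nth (vec_nth B i) j) = A ** B"
      using s0 by (simp add: A'_def matrix_matrix_mult_def vec_eq_iff field_simps)
    then show ?thesis unfolding invertible_right_inverse using B by metis
  qed
  ultimately show ?thesis unfolding projectively_equivalent_def by blast
qed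

theorem theorem4p1:
  fixes n d k :: nat
  assumes "CARD('v::finite) = n + 1"
    and "n \<ge> 1" and "d \<ge> 1"
    and "1 \<le> k" and "real k \<le> real d / 2 - 1"
  shows "\<exists>U :: 'v cpoly set. zariski_open d U \<and> U \<noteq> {} \<and>
           (\<forall>f\<in>U. \<forall>g\<in>U. milnor_isomorphic k f g \<longrightarrow> projectively_equivalent f g)"
proof -
  have kd: "2 * Suc k \<le> d"
  proof -
    have "real (2 * Suc k) \<le> real d" using assms(5) by (simp add: field_simps)
    then show ?thesis by (simp only: of_nat_le_iff)
  qed
  obtain U :: "'v cpoly set" where U: "zariski_open d U" "U \<noteq> {}" "U \<subseteq> homogeneous d"
    and indep: "\<And>g. g \<in> U \<Longrightarrow> shift_independent (Suc k) (divided_coeff g)"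
    using generic_shift_independent[OF kd] by blast
  have "projectively_equivalent f g"
    if fU: "f \<in> U" and gU: "g \<in> U" and iso: "milnor_isomorphic k f g" for f g
  proof -
    have f: "f \<in> homogeneous d" and g: "g \<in> homogeneous d" using fU gU U(3) by auto
    obtain A where A: "invertible A"
      "\<And>p. p \<in> jacobian_ideal k f \<Longrightarrow> linear_subst A p \<in> jacobian_ideal k g"
      by (rule milnor_isomorphic_imp_linear_subst[OF _ f iso]) (use kd in auto)
    have "\<exists>c. linear_subst A f = const c * g"
      by (rule linear_subst_eq_const_mult[OF _ assms(4) _ f g indep[OF gU] A(2)])
        (use assms(1,2) kd in auto)
    then obtain c where c: "linear_subst A f = const c * g" by blast
    have "c \<noteq> 0"
    proof
      assume "c = 0"
      then have "f = 0" using c linear_subst_eq_0[OF A(1)] by simp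
      then show False using shift_independent_nonzero[OF indep[OF fU]] by simp
    qed
    then show ?thesis
      using projectively_equivalent_if_const_mult[OF f _ A(1) c] assms(3) by simp
  qed
  with U(1,2) show ?thesis by blast
qed

end
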